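(* Let $n$ be a positive integer. $\mathbb{Z}A_n$ contains a free pair formed by a power of a bicyclic unit and a Bass cyclic unit if and only if $n\ge 5$. Likewise, $\mathbb{Z}S_n$ contains a free pair formed by a power of a bicyclic unit and a Bass cyclic unit if and only if $n\ge 5$.
   Context: $S_n$ and $A_n$ are the symmetric and alternating groups on $n$ symbols, and $\mathbb{Z}G$ is the integral group ring of a group $G$. The bicyclic units of $\mathbb{Z}G$ are the elements of one of the forms $1+(1-h)x(1+h+h^2+\cdots+h^{d-1})$ or $1+(1+h+h^2+\cdots+h^{d-1})x(1-h)$, where $x,h\in G$ and $h$ has order $d$. The Bass cyclic units of $\mathbb{Z}G$ are the elements of the form $u_{k,m}(x)=(1+x+x^2+\cdots+x^{k-1})^m+\frac{1-k^m}{d}(1+x+x^2+\cdots+x^{d-1})$, where $x\in G$ has order $d$ and $k,m$ are positive integers with $\gcd(k,d)=1$ and $\phi(d)\mid m$ ($\phi$ is the Euler function). A pair $(g,h)$ of elements of a group is a free pair if $\langle g,h\rangle$ is a non-abelian free group (free on the two generators $g,h$). *)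

theory Defs
  imports "HOL-Algebra.Algebra" "HOL-Number_Theory.Totient"
begin

text \<open>
  Elements of the integral group ring are the finitely supported functions from the group to the
  integers.  As no extensionality is built into the function type, they are required to vanish
  outside the carrier of the group.  The product is convolution.
\<close>

definition group_ring :: "('a, 'b) monoid_scheme \<Rightarrow> ('a \<Rightarrow> int) ring" where
  "group_ring G =
    \<lparr> carrier = {f. finite {x. f x \<noteq> 0} \<and> {x. f x \<noteq> 0} \<subseteq> carrier G},
      monoid.mult = (\<lambda>f g x. \<Sum>(y, z) \<in> {(y, z). f y \<noteq> 0 \<and> g z \<noteq> 0 \<and> y \<otimes>\<^bsub>G\<^esub> z = x}. f y * g z),
      one = (\<lambda>x. if x = \<one>\<^bsub>G\<^esub> then 1 else 0),
      ring.zero = (\<lambda>x. 0),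
      ring.add = (\<lambda>f g x. f x + g x) \<rparr>"

definition group_elem :: "'a \<Rightarrow> 'a \<Rightarrow> int" where
  "group_elem g = (\<lambda>x. if x = g then 1 else 0)"

lemma group_ring_mult_eq:
  assumes "finite A" "finite B" "{x. f x \<noteq> 0} \<subseteq> A" "{x. g x \<noteq> 0} \<subseteq> B"
  shows "(f \<otimes>\<^bsub>group_ring G\<^esub> g) x = (\<Sum>y\<in>A. \<Sum>z\<in>B. if y \<otimes>\<^bsub>G\<^esub> z = x then f y * g z else 0)"
proof -
  have "(f \<otimes>\<^bsub>group_ring G\<^esub> g) x
      = (\<Sum>(y, z) \<in> {(y, z). f y \<noteq> 0 \<and> g z \<noteq> 0 \<and> y \<otimes>\<^bsub>G\<^esub> z = x}. if y \<otimes>\<^bsub>G\<^esub> z = x then f y * g z else 0)"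
    unfolding group_ring_def by (auto intro!: sum.cong)
  also have "\<dots> = (\<Sum>(y, z) \<in> A \<times> B. if y \<otimes>\<^bsub>G\<^esub> z = x then f y * g z else 0)"
    using assms by (intro sum.mono_neutral_left) auto
  finally show ?thesis by (simp add: sum.cartesian_product)
qed

lemma group_ring_add: "(f \<oplus>\<^bsub>group_ring G\<^esub> g) x = f x + g x"
  and group_ring_zero: "\<zero>\<^bsub>group_ring G\<^esub> = (\<lambda>x. 0)"
  and group_ring_one: "\<one>\<^bsub>group_ring G\<^esub> = group_elem \<one>\<^bsub>G\<^esub>"
  and group_ring_carrier:
    "f \<in> carrier (group_ring G) \<longleftrightarrow> finite {x. f x \<noteq> 0} \<and> {x. f x \<noteq> 0} \<subseteq> carrier G"
  by (simp_all add: group_ring_def group_elem_def)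

lemma group_ring_mult_supp:
  "{x. (f \<otimes>\<^bsub>group_ring G\<^esub> g) x \<noteq> 0} \<subseteq> (\<lambda>(y, z). y \<otimes>\<^bsub>G\<^esub> z) ` ({x. f x \<noteq> 0} \<times> {x. g x \<noteq> 0})"
proof
  fix x assume "x \<in> {x. (f \<otimes>\<^bsub>group_ring G\<^esub> g) x \<noteq> 0}"
  then have "(\<Sum>(y, z) \<in> {(y, z). f y \<noteq> 0 \<and> g z \<noteq> 0 \<and> y \<otimes>\<^bsub>G\<^esub> z = x}. f y * g z) \<noteq> 0"
    by (simp add: group_ring_def)
  then obtain p where "p \<in> {(y, z). f y \<noteq> 0 \<and> g z \<noteq> 0 \<and> y \<otimes>\<^bsub>G\<^esub> z = x}"
    by (rule sum.not_neutral_contains_not_neutral)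
  then show "x \<in> (\<lambda>(y, z). y \<otimes>\<^bsub>G\<^esub> z) ` ({x. f x \<noteq> 0} \<times> {x. g x \<noteq> 0})" by force
qed

lemma group_elem_carrier: "g \<in> carrier G \<Longrightarrow> group_elem g \<in> carrier (group_ring G)"
  by (auto simp: group_ring_carrier group_elem_def)

lemma group_elem_mult:
  "group_elem g \<otimes>\<^bsub>group_ring G\<^esub> group_elem h = group_elem (g \<otimes>\<^bsub>G\<^esub> h)"
  by (rule ext, subst group_ring_mult_eq[of "{g}" "{h}"]) (auto simp: group_elem_def cong: if_cong)

lemma group_ring_is_ring:
  assumes "monoid G"
  shows "ring (group_ring G)"
proof -
  interpret monoid G by fact
  let ?R = "group_ring G"
  have ab: "abelian_group ?R"
  proof (rule abelian_groupI)
    fix f assume f: "f \<in> carrier ?R"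
    show "\<exists>g\<in>carrier ?R. g \<oplus>\<^bsub>?R\<^esub> f = \<zero>\<^bsub>?R\<^esub>"
      by (rule bexI[of _ "\<lambda>x. - f x"])
         (use f in \<open>auto simp: group_ring_carrier group_ring_add group_ring_zero fun_eq_iff\<close>)
  next
    fix f g assume fg: "f \<in> carrier ?R" "g \<in> carrier ?R"
    have "{x. f x + g x \<noteq> 0} \<subseteq> {x. f x \<noteq> 0} \<union> {x. g x \<noteq> 0}" by auto
    then show "f \<oplus>\<^bsub>?R\<^esub> g \<in> carrier ?R"
      using fg unfolding group_ring_carrier group_ring_add
      by (meson finite_Un finite_subset le_sup_iff order_trans)
  qed (auto simp: group_ring_carrier group_ring_add group_ring_zero fun_eq_iff)
  have mc: "f \<otimes>\<^bsub>?R\<^esub> g \<in> carrier ?R" if fg: "f \<in> carrier ?R" "g \<in> carrier ?R" for f g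
  proof -
    let ?P = "(\<lambda>(y, z). y \<otimes>\<^bsub>G\<^esub> z) ` ({x. f x \<noteq> 0} \<times> {x. g x \<noteq> 0})"
    have "finite ?P" "?P \<subseteq> carrier G"
      using fg by (auto simp: group_ring_carrier)
    then show ?thesis
      by (subst group_ring_carrier)
        (rule conjI finite_subset[OF group_ring_mult_supp] order_trans[OF group_ring_mult_supp]; assumption?)+
  qed
  have assoc: "(f \<otimes>\<^bsub>?R\<^esub> g) \<otimes>\<^bsub>?R\<^esub> h = f \<otimes>\<^bsub>?R\<^esub> (g \<otimes>\<^bsub>?R\<^esub> h)"
    if fgh: "f \<in> carrier ?R" "g \<in> carrier ?R" "h \<in> carrier ?R" for f g h
  proof
    fix x
    define A B C where "A = {x. f x \<noteq> 0}" and "B = {x. g x \<noteq> 0}" and "C = {x. h x \<noteq> 0}"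
    define AB BC where "AB = (\<lambda>(y, z). y \<otimes>\<^bsub>G\<^esub> z) ` (A \<times> B)"
      and "BC = (\<lambda>(y, z). y \<otimes>\<^bsub>G\<^esub> z) ` (B \<times> C)"
    have fin: "finite A" "finite B" "finite C" "finite AB" "finite BC"
      and sub: "A \<subseteq> carrier G" "B \<subseteq> carrier G" "C \<subseteq> carrier G"
      using fgh by (auto simp: A_def B_def C_def AB_def BC_def group_ring_carrier)
    have "((f \<otimes>\<^bsub>?R\<^esub> g) \<otimes>\<^bsub>?R\<^esub> h) x
        = (\<Sum>w\<in>AB. \<Sum>c\<in>C. if w \<otimes>\<^bsub>G\<^esub> c = x then (f \<otimes>\<^bsub>?R\<^esub> g) w * h c else 0)"
      by (rule group_ring_mult_eq)
         (use fin group_ring_mult_supp[where f=f and g=g and G=G] in \<open>auto simp: AB_def A_def B_def C_def\<close>)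
    also have "\<dots> = (\<Sum>w\<in>AB. \<Sum>c\<in>C. \<Sum>a\<in>A. \<Sum>b\<in>B.
        if a \<otimes>\<^bsub>G\<^esub> b = w then (if w \<otimes>\<^bsub>G\<^esub> c = x then f a * g b * h c else 0) else 0)"
      by (intro sum.cong refl, subst group_ring_mult_eq[OF fin(1,2)])
         (auto simp: A_def B_def sum_distrib_right cong: if_cong intro!: sum.cong)
    also have "\<dots> = (\<Sum>c\<in>C. \<Sum>a\<in>A. \<Sum>b\<in>B. \<Sum>w\<in>AB.
        if a \<otimes>\<^bsub>G\<^esub> b = w then (if w \<otimes>\<^bsub>G\<^esub> c = x then f a * g b * h c else 0) else 0)"
      by (rule trans[OF sum.swap], rule sum.cong[OF refl], rule trans[OF sum.swap],
          rule sum.cong[OF refl], rule sum.swap)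
    also have "\<dots> = (\<Sum>c\<in>C. \<Sum>a\<in>A. \<Sum>b\<in>B. if a \<otimes>\<^bsub>G\<^esub> b \<otimes>\<^bsub>G\<^esub> c = x then f a * g b * h c else 0)"
      using fin by (intro sum.cong refl) (auto simp: AB_def sum.delta')
    also have "\<dots> = (\<Sum>a\<in>A. \<Sum>b\<in>B. \<Sum>c\<in>C. if a \<otimes>\<^bsub>G\<^esub> b \<otimes>\<^bsub>G\<^esub> c = x then f a * g b * h c else 0)"
      by (rule trans[OF sum.swap], rule sum.cong[OF refl], rule sum.swap)
    also have "\<dots> = (\<Sum>a\<in>A. \<Sum>b\<in>B. \<Sum>c\<in>C. if a \<otimes>\<^bsub>G\<^esub> (b \<otimes>\<^bsub>G\<^esub> c) = x then f a * (g b * h c) else 0)"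
      using sub by (intro sum.cong refl) (auto simp: m_assoc subset_eq mult.assoc)
    also have "\<dots> = (\<Sum>a\<in>A. \<Sum>b\<in>B. \<Sum>c\<in>C. \<Sum>w\<in>BC.
        if b \<otimes>\<^bsub>G\<^esub> c = w then (if a \<otimes>\<^bsub>G\<^esub> w = x then f a * (g b * h c) else 0) else 0)"
      using fin by (intro sum.cong refl) (auto simp: BC_def sum.delta')
    also have "\<dots> = (\<Sum>a\<in>A. \<Sum>w\<in>BC. \<Sum>b\<in>B. \<Sum>c\<in>C.
        if b \<otimes>\<^bsub>G\<^esub> c = w then (if a \<otimes>\<^bsub>G\<^esub> w = x then f a * (g b * h c) else 0) else 0)"
      by (rule sum.cong[OF refl], rule trans[OF _ sum.swap], rule sum.cong[OF refl], rule sum.swap)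
    also have "\<dots> = (\<Sum>a\<in>A. \<Sum>w\<in>BC. if a \<otimes>\<^bsub>G\<^esub> w = x then f a * (g \<otimes>\<^bsub>?R\<^esub> h) w else 0)"
      by (intro sum.cong refl, subst group_ring_mult_eq[OF fin(2,3)])
         (auto simp: B_def C_def sum_distrib_left cong: if_cong intro!: sum.cong)
    also have "\<dots> = (f \<otimes>\<^bsub>?R\<^esub> (g \<otimes>\<^bsub>?R\<^esub> h)) x"
      by (rule group_ring_mult_eq[symmetric])
         (use fin group_ring_mult_supp[where f=g and g=h and G=G] in \<open>auto simp: BC_def A_def B_def C_def\<close>)
    finally show "((f \<otimes>\<^bsub>?R\<^esub> g) \<otimes>\<^bsub>?R\<^esub> h) x = (f \<otimes>\<^bsub>?R\<^esub> (g \<otimes>\<^bsub>?R\<^esub> h)) x" .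
  qed
  show ?thesis
  proof (rule ringI[OF ab])
    show "monoid ?R"
    proof (rule monoidI)
      show "\<one>\<^bsub>?R\<^esub> \<in> carrier ?R" by (simp add: group_ring_one group_elem_carrier)
      fix f assume f: "f \<in> carrier ?R"
      let ?A = "{x. f x \<noteq> 0}"
      have A: "finite ?A" "?A \<subseteq> carrier G" using f by (auto simp: group_ring_carrier)
      have one: "{x. group_elem \<one>\<^bsub>G\<^esub> x \<noteq> 0} \<subseteq> {\<one>\<^bsub>G\<^esub>}"
        by (auto simp: group_elem_def cong: if_cong)
      show "\<one>\<^bsub>?R\<^esub> \<otimes>\<^bsub>?R\<^esub> f = f"
      proof
        fix x
        have "(\<one>\<^bsub>?R\<^esub> \<otimes>\<^bsub>?R\<^esub> f) x = (\<Sum>z\<in>?A. if \<one>\<^bsub>G\<^esub> \<otimes>\<^bsub>G\<^esub> z = x then f z else 0)"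
          unfolding group_ring_one using A(1) one
          by (subst group_ring_mult_eq[of "{\<one>\<^bsub>G\<^esub>}" ?A]) (auto simp: group_elem_def cong: if_cong)
        also have "\<dots> = (\<Sum>z\<in>?A. if z = x then f z else 0)"
          using A(2) by (intro sum.cong) auto
        finally show "(\<one>\<^bsub>?R\<^esub> \<otimes>\<^bsub>?R\<^esub> f) x = f x" using A(1) by simp
      qed
      show "f \<otimes>\<^bsub>?R\<^esub> \<one>\<^bsub>?R\<^esub> = f"
      proof
        fix x
        have "(f \<otimes>\<^bsub>?R\<^esub> \<one>\<^bsub>?R\<^esub>) x = (\<Sum>z\<in>?A. if z \<otimes>\<^bsub>G\<^esub> \<one>\<^bsub>G\<^esub> = x then f z else 0)"
          unfolding group_ring_one using A(1) one
          by (subst group_ring_mult_eq[of ?A "{\<one>\<^bsub>G\<^esub>}"]) (auto simp: group_elem_def cong: if_cong)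
        also have "\<dots> = (\<Sum>z\<in>?A. if z = x then f z else 0)"
          using A(2) by (intro sum.cong) auto
        finally show "(f \<otimes>\<^bsub>?R\<^esub> \<one>\<^bsub>?R\<^esub>) x = f x" using A(1) by simp
      qed
    qed (use mc assoc in auto)
  next
    fix f g h assume fgh: "f \<in> carrier ?R" "g \<in> carrier ?R" "h \<in> carrier ?R"
    define S where "S = {x. f x \<noteq> 0} \<union> {x. g x \<noteq> 0} \<union> {x. h x \<noteq> 0}"
    have S: "finite S" "{x. f x \<noteq> 0} \<subseteq> S" "{x. g x \<noteq> 0} \<subseteq> S" "{x. h x \<noteq> 0} \<subseteq> S"
      "{x. (f \<oplus>\<^bsub>?R\<^esub> g) x \<noteq> 0} \<subseteq> S"
      using fgh by (auto simp: S_def group_ring_carrier group_ring_add)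
    note mult = group_ring_mult_eq[OF S(1,1)]
    show "(f \<oplus>\<^bsub>?R\<^esub> g) \<otimes>\<^bsub>?R\<^esub> h = f \<otimes>\<^bsub>?R\<^esub> h \<oplus>\<^bsub>?R\<^esub> g \<otimes>\<^bsub>?R\<^esub> h"
    proof
      fix x show "((f \<oplus>\<^bsub>?R\<^esub> g) \<otimes>\<^bsub>?R\<^esub> h) x = (f \<otimes>\<^bsub>?R\<^esub> h \<oplus>\<^bsub>?R\<^esub> g \<otimes>\<^bsub>?R\<^esub> h) x"
        unfolding group_ring_add mult[OF S(2,4)] mult[OF S(3,4)] mult[OF S(5,4)] sum.distrib[symmetric]
        by (intro sum.cong) (auto simp: algebra_simps)
    qed
    show "h \<otimes>\<^bsub>?R\<^esub> (f \<oplus>\<^bsub>?R\<^esub> g) = h \<otimes>\<^bsub>?R\<^esub> f \<oplus>\<^bsub>?R\<^esub> h \<otimes>\<^bsub>?R\<^esub> g"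
    proof
      fix x show "(h \<otimes>\<^bsub>?R\<^esub> (f \<oplus>\<^bsub>?R\<^esub> g)) x = (h \<otimes>\<^bsub>?R\<^esub> f \<oplus>\<^bsub>?R\<^esub> h \<otimes>\<^bsub>?R\<^esub> g) x"
        unfolding group_ring_add mult[OF S(4,2)] mult[OF S(4,3)] mult[OF S(4,5)] sum.distrib[symmetric]
        by (intro sum.cong) (auto simp: algebra_simps)
    qed
  qed
qed

text \<open>The geometric sum \<open>1 + g + \<dots> + g ^ (k - 1)\<close> of a group element \<open>g\<close> in the group ring.\<close>

definition geom_elem :: "('a, 'b) monoid_scheme \<Rightarrow> 'a \<Rightarrow> nat \<Rightarrow> 'a \<Rightarrow> int" where
  "geom_elem G g k =
    (\<Oplus>\<^bsub>group_ring G\<^esub> i \<in> {..<k}. group_elem (g [^]\<^bsub>G\<^esub> i))"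

definition bicyclic_units :: "('a, 'b) monoid_scheme \<Rightarrow> ('a \<Rightarrow> int) set" where
  "bicyclic_units G = (let R = group_ring G in
    {\<one>\<^bsub>R\<^esub> \<oplus>\<^bsub>R\<^esub> (\<one>\<^bsub>R\<^esub> \<ominus>\<^bsub>R\<^esub> group_elem h) \<otimes>\<^bsub>R\<^esub> group_elem x \<otimes>\<^bsub>R\<^esub> geom_elem G h (group.ord G h)
      | x h. x \<in> carrier G \<and> h \<in> carrier G} \<union>
    {\<one>\<^bsub>R\<^esub> \<oplus>\<^bsub>R\<^esub> geom_elem G h (group.ord G h) \<otimes>\<^bsub>R\<^esub> group_elem x \<otimes>\<^bsub>R\<^esub> (\<one>\<^bsub>R\<^esub> \<ominus>\<^bsub>R\<^esub> group_elem h)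
      | x h. x \<in> carrier G \<and> h \<in> carrier G})"

text \<open>
  The integer division is exact whenever \<open>k\<close> is coprime to the order \<open>d\<close> of \<open>x\<close> and \<open>totient d\<close>
  divides \<open>m\<close>, by Euler's theorem.
\<close>

definition bass_unit :: "('a, 'b) monoid_scheme \<Rightarrow> nat \<Rightarrow> nat \<Rightarrow> 'a \<Rightarrow> 'a \<Rightarrow> int" where
  "bass_unit G k m x = (let R = group_ring G; d = group.ord G x in
    geom_elem G x k [^]\<^bsub>R\<^esub> m \<oplus>\<^bsub>R\<^esub> add_pow R ((1 - int k ^ m) div int d) (geom_elem G x d))"

definition bass_cyclic_units :: "('a, 'b) monoid_scheme \<Rightarrow> ('a \<Rightarrow> int) set" where
  "bass_cyclic_units G =
    {bass_unit G k m x | k m x. x \<in> carrier G \<and> 0 < k \<and> 0 < m \<and>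
       coprime k (group.ord G x) \<and> totient (group.ord G x) dvd m}"

text \<open>
  Words in two letters and their formal inverses: in a letter \<open>(i, e)\<close>, \<open>i\<close> selects the first
  (\<open>True\<close>) or second generator, and \<open>e\<close> tells whether it occurs with exponent \<open>1\<close> (\<open>True\<close>) or
  \<open>- 1\<close>.  A word is reduced if no two adjacent letters cancel; the reduced words are the elements
  of the free group of rank two.
\<close>

definition reduced_word :: "(bool \<times> bool) list \<Rightarrow> bool" where
  "reduced_word w \<longleftrightarrow>
    (\<forall>j. Suc j < length w \<longrightarrow> \<not> (fst (w ! j) = fst (w ! Suc j) \<and> snd (w ! j) \<noteq> snd (w ! Suc j)))"

fun word_eval :: "('a, 'b) monoid_scheme \<Rightarrow> 'a \<Rightarrow> 'a \<Rightarrow> (bool \<times> bool) list \<Rightarrow> 'a" where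
  "word_eval G g h [] = \<one>\<^bsub>G\<^esub>"
| "word_eval G g h ((i, e) # w) =
    (let a = (if i then g else h) in if e then a else inv\<^bsub>G\<^esub> a) \<otimes>\<^bsub>G\<^esub> word_eval G g h w"

text \<open>
  The subgroup generated by \<open>g\<close> and \<open>h\<close> is free on \<open>g\<close>, \<open>h\<close>: every element of it is the value of
  exactly one reduced word.
\<close>

definition free_pair :: "('a, 'b) monoid_scheme \<Rightarrow> 'a \<Rightarrow> 'a \<Rightarrow> bool" where
  "free_pair G g h \<longleftrightarrow> g \<in> carrier G \<and> h \<in> carrier G \<and>
    bij_betw (word_eval G g h) {w. reduced_word w} (generate G {g, h})"

end

theory Submission
  imports Defs "HOL-Computational_Algebra.Polynomial" "HOL-Number_Theory.Residues"
    "HOL-Number_Theory.Fib"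
begin

text \<open>
  For \<open>n \<le> 4\<close> every permutation of \<open>n\<close> letters has order \<open>d \<le> 4\<close>, so a residue coprime to
  \<open>d\<close> is \<open>1\<close> or \<open>- 1\<close>.  Modulo \<open>1 + x + \<dots> + x ^ (d - 1)\<close> the sum \<open>1 + x + \<dots> + x ^ (k - 1)\<close>
  is then \<open>1\<close> or \<open>- x ^ (d - 1)\<close>, a root of unity.  The correction term of a Bass cyclic unit is
  the multiple of \<open>1 + x + \<dots> + x ^ (d - 1)\<close> that makes the augmentation \<open>1\<close>, and this turns the
  unit into an element of finite order, which cannot belong to a free pair
  (\<open>bass_poly_torsion\<close>, \<open>free_pair_no_torsion\<close>).

  For \<open>n \<ge> 5\<close> take \<open>h = (1 2)(4 5)\<close>, \<open>x = (1 3 2)\<close> and \<open>y = (1 2 3 4 5)\<close>, all even, the bicyclic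
  unit \<open>b = 1 + (1 - h) x (1 + h)\<close> and the Bass cyclic unit \<open>u = u\<^sub>3\<^sub>,\<^sub>2\<^sub>0(y)\<close>.  Let them act on
  integer functions on the letters by permuting coordinates.  On functions of sum zero that are
  supported on the five letters, \<open>1 + y + \<dots> + y\<^sup>4\<close> vanishes, and \<open>1 + y + y\<^sup>2 = y (1 + \<sigma>)\<close> with
  \<open>\<sigma> = y + y\<^sup>-\<^sup>1\<close>.  Since \<open>y\<^sup>2\<^sup>0 = 1\<close>, the unit \<open>u\<close> acts as \<open>(1 + \<sigma>)\<^sup>2\<^sup>0\<close>, where
  \<open>\<sigma>\<^sup>2 + \<sigma> = 1\<close>.  The nilpotent part \<open>(1 - h) x (1 + h)\<close> of \<open>b\<close> has rank one there, with image
  spanned by \<open>w = \<delta>\<^sub>1 - \<delta>\<^sub>2\<close>, and it sends \<open>\<sigma> w\<close> to \<open>2 w\<close>.  So the plane spanned by \<open>w\<close> and \<open>\<sigma> w\<close>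
  is invariant under both units: \<open>b\<close> acts as the transvection \<open>(p, q) \<mapsto> (p + 2 q, q)\<close>
  (\<open>act_b0\<close>) and \<open>u\<close> as the 20th power of the Fibonacci matrix \<open>(p, q) \<mapsto> (p + q, p)\<close>
  (\<open>act_u0\<close>).  The second matrix is hyperbolic, and its two eigenlines differ
  from the line of \<open>w\<close>, the only one that \<open>b\<close> fixes, so ping-pong on cones of the plane shows that \<open>b\<^sup>3\<close> and \<open>u\<close> generate a
  free group (\<open>region_step\<close>, \<open>free_pair_by_ping_pong\<close>).  The whole argument only involves
  \<open>h\<close>, \<open>x\<close>, \<open>y\<close>, hence applies to every group of permutations of \<open>{1..n}\<close> that contains them.
\<close>

section \<open>Words in two letters and the ping-pong criterion\<close>

definition letter_value :: "('a, 'b) monoid_scheme \<Rightarrow> 'a \<Rightarrow> 'a \<Rightarrow> bool \<times> bool \<Rightarrow> 'a" where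
  "letter_value G g h l =
    (let a = (if fst l then g else h) in if snd l then a else inv\<^bsub>G\<^esub> a)"

definition cancelling :: "bool \<times> bool \<Rightarrow> bool \<times> bool \<Rightarrow> bool" where
  "cancelling l l' \<longleftrightarrow> fst l = fst l' \<and> snd l \<noteq> snd l'"

lemma word_eval_Cons:
  "word_eval G g h (l # w) = letter_value G g h l \<otimes>\<^bsub>G\<^esub> word_eval G g h w"
  by (cases l) (simp add: letter_value_def)

lemma reduced_word_Nil: "reduced_word []"
  by (simp add: reduced_word_def)

lemma reduced_word_single: "reduced_word [l]"
  by (simp add: reduced_word_def)

lemma reduced_word_Cons_Cons:
  "reduced_word (l # l' # w) \<longleftrightarrow> \<not> cancelling l l' \<and> reduced_word (l' # w)"
  unfolding reduced_word_def cancelling_def by (auto simp: nth_Cons split: nat.splits)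

lemma reduced_word_tail: "reduced_word (l # w) \<Longrightarrow> reduced_word w"
  by (cases w) (auto simp: reduced_word_Nil reduced_word_Cons_Cons)

lemma reduced_word_replicate: "reduced_word (replicate n l)"
  by (simp add: reduced_word_def)

context group
begin

lemma letter_value_closed:
  assumes "g \<in> carrier G" "h \<in> carrier G"
  shows "letter_value G g h l \<in> carrier G"
  using assms by (simp add: letter_value_def Let_def)

lemma word_eval_closed:
  assumes "g \<in> carrier G" "h \<in> carrier G"
  shows "word_eval G g h w \<in> carrier G"
  by (induction w) (simp_all add: word_eval_Cons letter_value_closed[OF assms] del: word_eval.simps(2))

lemma letter_value_cancelling:
  assumes "g \<in> carrier G" "h \<in> carrier G" "cancelling l l'"
  shows "letter_value G g h l \<otimes> letter_value G g h l' = \<one>"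
  using assms by (auto simp: letter_value_def Let_def cancelling_def)

lemma word_eval_append:
  assumes "g \<in> carrier G" "h \<in> carrier G"
  shows "word_eval G g h (v @ w) = word_eval G g h v \<otimes> word_eval G g h w"
  by (induction v)
     (simp_all add: word_eval_Cons m_assoc letter_value_closed[OF assms] word_eval_closed[OF assms]
       del: word_eval.simps(2))

lemma word_eval_in_generate:
  assumes "g \<in> carrier G" "h \<in> carrier G"
  shows "word_eval G g h w \<in> generate G {g, h}"
proof (induction w)
  case (Cons l w)
  have "letter_value G g h l \<in> generate G {g, h}"
    by (auto simp: letter_value_def Let_def intro: generate.incl generate.inv)
  with Cons show ?case by (simp only: word_eval_Cons generate.eng)
qed (simp add: generate.one)

text \<open>
  Cancellation from the right: a letter put in front of a reduced word either keeps it reduced or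
  cancels against its first letter, leaving the reduced tail.
\<close>

lemma reduced_representative:
  assumes "g \<in> carrier G" "h \<in> carrier G"
  shows "\<exists>v. reduced_word v \<and> word_eval G g h v = word_eval G g h w"
proof (induction w)
  case Nil
  show ?case using reduced_word_Nil by blast
next
  case (Cons l w)
  then obtain v where v: "reduced_word v" "word_eval G g h v = word_eval G g h w" by blast
  show ?case
  proof (cases "\<exists>l' v'. v = l' # v' \<and> cancelling l l'")
    case True
    then obtain l' v' where l': "v = l' # v'" "cancelling l l'" by blast
    have "word_eval G g h (l # w) = letter_value G g h l \<otimes> (letter_value G g h l' \<otimes> word_eval G g h v')"
      using v(2) l'(1) by (simp only: word_eval_Cons)
    also have "\<dots> = word_eval G g h v'"
      using l'(2) by (simp add: m_assoc[symmetric] letter_value_cancelling letter_value_closed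
          word_eval_closed assms)
    finally show ?thesis using v(1) l'(1) reduced_word_tail by metis
  next
    case False
    then have "reduced_word (l # v)"
      using v(1) by (cases v) (auto simp: reduced_word_single reduced_word_Cons_Cons)
    moreover have "word_eval G g h (l # v) = word_eval G g h (l # w)"
      using v(2) by (simp only: word_eval_Cons)
    ultimately show ?thesis by blast
  qed
qed

lemma generate_eq_reduced_words:
  assumes "g \<in> carrier G" "h \<in> carrier G"
  shows "generate G {g, h} = word_eval G g h ` {w. reduced_word w}"
proof
  have "a \<in> range (word_eval G g h)" if "a \<in> generate G {g, h}" for a
    using that
  proof (induction rule: generate.induct)
    case one
    show ?case by (rule range_eqI[of _ _ "[]"]) simp
  next
    case (incl a)
    then have "a = word_eval G g h [(a = g, True)]" using assms by (auto simp: Let_def)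
    then show ?case by blast
  next
    case (inv a)
    then have "inv a = word_eval G g h [(a = g, False)]" using assms by (auto simp: Let_def)
    then show ?case by blast
  next
    case (eng a b)
    then obtain v w where "a = word_eval G g h v" "b = word_eval G g h w" by blast
    then have "a \<otimes> b = word_eval G g h (v @ w)" using word_eval_append[OF assms] by simp
    then show ?case by blast
  qed
  then show "generate G {g, h} \<subseteq> word_eval G g h ` {w. reduced_word w}"
    using reduced_representative[OF assms] by (smt (verit) image_iff mem_Collect_eq rangeE subsetI)
  show "word_eval G g h ` {w. reduced_word w} \<subseteq> generate G {g, h}"
    using word_eval_in_generate[OF assms] by blast
qed

text \<open>
  Ping-pong with one region per letter: a nonempty reduced word carries the base point into the
  region of its first letter.  So the regions visited recover a reduced word from its value, one
  letter at a time, and two different reduced words cannot have the same value.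
\<close>

lemma free_pair_by_ping_pong:
  fixes T :: "'a \<Rightarrow> 'v \<Rightarrow> 'v" and D :: "bool \<times> bool \<Rightarrow> 'v set"
  assumes gh: "g \<in> carrier G" "h \<in> carrier G"
    and T_mult: "\<And>a b v. a \<in> carrier G \<Longrightarrow> b \<in> carrier G \<Longrightarrow> T (a \<otimes> b) v = T a (T b v)"
    and T_one: "T \<one> v0 = v0"
    and step: "\<And>l l' v. \<not> cancelling l l' \<Longrightarrow> v \<in> D l' \<Longrightarrow> T (letter_value G g h l) v \<in> D l"
    and base: "\<And>l. T (letter_value G g h l) v0 \<in> D l" "\<And>l. v0 \<notin> D l"
    and disjoint: "\<And>l l'. l \<noteq> l' \<Longrightarrow> D l \<inter> D l' = {}"
  shows "free_pair G g h"
proof -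
  note closed = letter_value_closed[OF gh] word_eval_closed[OF gh]
  have region: "T (word_eval G g h (l # w)) v0 \<in> D l" if "reduced_word (l # w)" for l w
    using that
  proof (induction w arbitrary: l)
    case Nil
    show ?case using base(1)[of l] closed by (simp add: word_eval_Cons del: word_eval.simps(2))
  next
    case (Cons l' w)
    then have "T (word_eval G g h (l' # w)) v0 \<in> D l'" "\<not> cancelling l l'"
      by (auto simp: reduced_word_Cons_Cons)
    then have "T (letter_value G g h l) (T (word_eval G g h (l' # w)) v0) \<in> D l" by (metis step)
    then show ?case using closed by (simp only: word_eval_Cons[of _ _ _ l] T_mult)
  qed
  have nontrivial: "word_eval G g h (l # w) \<noteq> \<one>" if "reduced_word (l # w)" for l w
    using region[OF that] base(2)[of l] T_one by metis
  have eq: "v = w" if "reduced_word v" "reduced_word w" "word_eval G g h v = word_eval G g h w" for v w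
    using that
  proof (induction v arbitrary: w)
    case Nil
    then show ?case using nontrivial by (cases w) auto
  next
    case (Cons l v)
    show ?case
    proof (cases w)
      case Nil
      then show ?thesis using Cons.prems nontrivial by auto
    next
      case (Cons l' w')
      have "l = l'"
        using region[of l v] region[of l' w'] Cons.prems Cons disjoint[of l l'] by auto
      moreover have "word_eval G g h v = word_eval G g h w'"
        using Cons.prems(3) Cons \<open>l = l'\<close> closed
        by (simp add: word_eval_Cons del: word_eval.simps(2))
      ultimately show ?thesis
        using Cons Cons.IH[of w'] Cons.prems(1,2) reduced_word_tail by blast
    qed
  qed
  show ?thesis
    unfolding free_pair_def bij_betw_def generate_eq_reduced_words[OF gh]
    using gh eq by (auto intro: inj_onI)
qed

text \<open>A power of the second generator is the value of a reduced word.\<close>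

lemma free_pair_no_torsion:
  assumes "free_pair G g h" "0 < n"
  shows "h [^] (n :: nat) \<noteq> \<one>"
proof
  assume torsion: "h [^] n = \<one>"
  have gh: "g \<in> carrier G" "h \<in> carrier G" using assms(1) by (auto simp: free_pair_def)
  have "word_eval G g h (replicate m (False, True)) = h [^] m" for m
  proof (induction m)
    case (Suc m)
    then show ?case using nat_pow_Suc2[OF gh(2), of m] by simp
  qed simp
  then have "word_eval G g h (replicate n (False, True)) = word_eval G g h []"
    using torsion by simp
  moreover have "inj_on (word_eval G g h) {w. reduced_word w}"
    using assms(1) by (simp add: free_pair_def bij_betw_def)
  ultimately have "replicate n (False, True) = []"
    using reduced_word_replicate reduced_word_Nil by (metis inj_onD mem_Collect_eq)
  then show False using assms(2) by simp
qed

end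

section \<open>The group ring of a finite group\<close>

locale finite_group = group G for G (structure) +
  assumes finite_carrier: "finite (carrier G)"
begin

abbreviation R where "R \<equiv> group_ring G"

sublocale R: ring "group_ring G"
  by (rule group_ring_is_ring[OF is_monoid])

lemma mult_carrier_eq:
  assumes "f \<in> carrier R" "k \<in> carrier R"
  shows "(f \<otimes>\<^bsub>R\<^esub> k) x = (\<Sum>y\<in>carrier G. \<Sum>z\<in>carrier G. if y \<otimes> z = x then f y * k z else 0)"
  using assms by (intro group_ring_mult_eq) (auto simp: group_ring_carrier finite_carrier)

lemma minus_apply:
  assumes "f \<in> carrier R"
  shows "(\<ominus>\<^bsub>R\<^esub> f) = (\<lambda>x. - f x)"
proof -
  have "(\<lambda>x. - f x) \<in> carrier R" using assms by (simp add: group_ring_carrier)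
  moreover have "(\<lambda>x. - f x) \<oplus>\<^bsub>R\<^esub> f = \<zero>\<^bsub>R\<^esub>"
    by (simp add: fun_eq_iff group_ring_add group_ring_zero)
  ultimately show ?thesis using assms R.minus_equality by blast
qed

subsection \<open>Linear extension of functions on the group\<close>

text \<open>
  The linear map from the group ring to the integers that extends \<open>\<phi>\<close>.  Every coordinate of an
  action of the group ring on functions has this form.
\<close>

definition lin :: "('a \<Rightarrow> int) \<Rightarrow> ('a \<Rightarrow> int) \<Rightarrow> int" where
  "lin \<phi> f = (\<Sum>g\<in>carrier G. f g * \<phi> g)"

lemma lin_mult:
  assumes "f \<in> carrier R" "k \<in> carrier R"
  shows "lin \<phi> (f \<otimes>\<^bsub>R\<^esub> k) = lin (\<lambda>y. lin (\<lambda>z. \<phi> (y \<otimes> z)) k) f"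
proof -
  let ?C = "carrier G"
  have "lin \<phi> (f \<otimes>\<^bsub>R\<^esub> k) =
      (\<Sum>x\<in>?C. \<Sum>y\<in>?C. \<Sum>z\<in>?C. if y \<otimes> z = x then f y * k z * \<phi> x else 0)"
    unfolding lin_def mult_carrier_eq[OF assms]
    by (intro sum.cong refl) (auto simp: sum_distrib_right intro!: sum.cong)
  also have "\<dots> = (\<Sum>y\<in>?C. \<Sum>z\<in>?C. \<Sum>x\<in>?C. if y \<otimes> z = x then f y * k z * \<phi> x else 0)"
    by (rule trans[OF sum.swap], rule sum.cong[OF refl], rule sum.swap)
  also have "\<dots> = (\<Sum>y\<in>?C. \<Sum>z\<in>?C. f y * k z * \<phi> (y \<otimes> z))"
    using finite_carrier by (intro sum.cong refl) (auto simp: sum.delta')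
  also have "\<dots> = lin (\<lambda>y. lin (\<lambda>z. \<phi> (y \<otimes> z)) k) f"
    unfolding lin_def by (simp add: sum_distrib_left mult.assoc)
  finally show ?thesis .
qed

lemma lin_add: "lin \<phi> (f \<oplus>\<^bsub>R\<^esub> k) = lin \<phi> f + lin \<phi> k"
  by (simp add: lin_def group_ring_add sum.distrib algebra_simps)

lemma lin_zero: "lin \<phi> \<zero>\<^bsub>R\<^esub> = 0"
  by (simp add: lin_def group_ring_zero)

lemma lin_minus: "f \<in> carrier R \<Longrightarrow> k \<in> carrier R \<Longrightarrow> lin \<phi> (f \<ominus>\<^bsub>R\<^esub> k) = lin \<phi> f - lin \<phi> k"
  by (simp add: a_minus_def lin_add minus_apply) (simp add: lin_def sum_negf)

lemma lin_scale: "lin \<phi> (\<lambda>g. c * f g) = c * lin \<phi> f"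
  by (simp add: lin_def sum_distrib_left mult.assoc)

lemma lin_group_elem: "g \<in> carrier G \<Longrightarrow> lin \<phi> (group_elem g) = \<phi> g"
  using finite_carrier by (simp add: lin_def group_elem_def if_distrib[of "\<lambda>a. a * _"] cong: if_cong)

subsection \<open>Evaluation of integer polynomials at a group element\<close>

lemma scale_carrier: "f \<in> carrier R \<Longrightarrow> (\<lambda>g. c * f g) \<in> carrier R"
  by (auto simp: group_ring_carrier intro: rev_finite_subset)

lemma scale_mult:
  assumes "f \<in> carrier R" "k \<in> carrier R"
  shows "(\<lambda>g. c * f g) \<otimes>\<^bsub>R\<^esub> k = (\<lambda>g. c * (f \<otimes>\<^bsub>R\<^esub> k) g)"
    and "f \<otimes>\<^bsub>R\<^esub> (\<lambda>g. c * k g) = (\<lambda>g. c * (f \<otimes>\<^bsub>R\<^esub> k) g)"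
proof -
  have "((\<lambda>g. c * f g) \<otimes>\<^bsub>R\<^esub> k) x = c * (f \<otimes>\<^bsub>R\<^esub> k) x" for x
    unfolding mult_carrier_eq[OF scale_carrier[OF assms(1)] assms(2)] mult_carrier_eq[OF assms]
    by (auto simp: sum_distrib_left intro!: sum.cong)
  then show "(\<lambda>g. c * f g) \<otimes>\<^bsub>R\<^esub> k = (\<lambda>g. c * (f \<otimes>\<^bsub>R\<^esub> k) g)" by auto
  have "(f \<otimes>\<^bsub>R\<^esub> (\<lambda>g. c * k g)) x = c * (f \<otimes>\<^bsub>R\<^esub> k) x" for x
    unfolding mult_carrier_eq[OF assms(1) scale_carrier[OF assms(2)]] mult_carrier_eq[OF assms]
    by (auto simp: sum_distrib_left intro!: sum.cong)
  then show "f \<otimes>\<^bsub>R\<^esub> (\<lambda>g. c * k g) = (\<lambda>g. c * (f \<otimes>\<^bsub>R\<^esub> k) g)" by auto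
qed

lemma add_pow_eq_scale:
  assumes "f \<in> carrier R"
  shows "add_pow R (c :: int) f = (\<lambda>g. c * f g)"
proof -
  have nat: "add_pow R n f = (\<lambda>g. int n * f g)" for n :: nat
    by (induction n)
       (auto simp: R.add.nat_pow_0 group_ring_zero group_ring_add fun_eq_iff algebra_simps)
  show ?thesis
  proof (cases "0 \<le> c")
    case True
    then show ?thesis using nat by (simp add: add_pow_int_ge)
  next
    case False
    have "add_pow R c f = \<ominus>\<^bsub>R\<^esub> add_pow R (nat (- c)) f"
      by (rule add_pow_int_lt) (use False in simp)
    also have "\<dots> = \<ominus>\<^bsub>R\<^esub> (\<lambda>g. (- c) * f g)"
      using False by (simp only: nat) simp
    also have "\<dots> = (\<lambda>g. - ((- c) * f g))" by (rule minus_apply[OF scale_carrier[OF assms]])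
    finally show ?thesis by simp
  qed
qed

text \<open>
  Horner's scheme, for the ring homomorphism from \<open>\<int>[T]\<close> to \<open>\<int>G\<close> that sends \<open>T\<close> to \<open>x\<close>.
\<close>

definition eval_at :: "'a \<Rightarrow> int poly \<Rightarrow> 'a \<Rightarrow> int" where
  "eval_at x p =
    fold_coeffs (\<lambda>a f. (\<lambda>g. a * \<one>\<^bsub>R\<^esub> g) \<oplus>\<^bsub>R\<^esub> group_elem x \<otimes>\<^bsub>R\<^esub> f) p \<zero>\<^bsub>R\<^esub>"

lemma eval_at_0: "eval_at x 0 = \<zero>\<^bsub>R\<^esub>"
  by (simp add: eval_at_def)

lemma eval_at_pCons:
  assumes "x \<in> carrier G"
  shows "eval_at x (pCons a p) = (\<lambda>g. a * \<one>\<^bsub>R\<^esub> g) \<oplus>\<^bsub>R\<^esub> group_elem x \<otimes>\<^bsub>R\<^esub> eval_at x p"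
proof (cases "a = 0 \<and> p = 0")
  case True
  then show ?thesis using assms
    by (simp add: eval_at_0 group_elem_carrier) (simp add: group_ring_zero group_ring_add fun_eq_iff)
next
  case False
  then show ?thesis by (auto simp: eval_at_def)
qed

context
  fixes x assumes x: "x \<in> carrier G"
begin

lemma eval_at_carrier: "eval_at x p \<in> carrier R"
  by (induction p)
     (simp_all add: eval_at_0 eval_at_pCons[OF x] scale_carrier group_elem_carrier x)

lemma eval_at_add: "eval_at x (p + q) = eval_at x p \<oplus>\<^bsub>R\<^esub> eval_at x q"
proof (induction p q rule: poly_induct2)
  case 0
  show ?case by (simp add: eval_at_0)
next
  case (pCons a p b q)
  let ?X = "group_elem x"
  have X: "?X \<in> carrier R" by (rule group_elem_carrier[OF x])
  have "?X \<otimes>\<^bsub>R\<^esub> eval_at x (p + q) = ?X \<otimes>\<^bsub>R\<^esub> eval_at x p \<oplus>\<^bsub>R\<^esub> ?X \<otimes>\<^bsub>R\<^esub> eval_at x q"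
    using X eval_at_carrier by (simp only: pCons R.r_distr)
  then show ?case by (simp add: eval_at_pCons[OF x] fun_eq_iff group_ring_add algebra_simps)
qed

lemma eval_at_smult: "eval_at x (smult c p) = (\<lambda>g. c * eval_at x p g)"
proof (induction p)
  case 0
  show ?case by (simp add: eval_at_0 group_ring_zero)
next
  case (pCons a p)
  have "group_elem x \<otimes>\<^bsub>R\<^esub> eval_at x (smult c p) = (\<lambda>g. c * (group_elem x \<otimes>\<^bsub>R\<^esub> eval_at x p) g)"
    unfolding pCons(2) by (rule scale_mult(2)[OF group_elem_carrier[OF x] eval_at_carrier])
  then show ?case by (simp add: eval_at_pCons[OF x] fun_eq_iff group_ring_add algebra_simps)
qed

lemma eval_at_mult: "eval_at x (p * q) = eval_at x p \<otimes>\<^bsub>R\<^esub> eval_at x q"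
proof (induction p)
  case 0
  show ?case by (simp add: eval_at_0 eval_at_carrier)
next
  case (pCons a p)
  let ?X = "group_elem x"
  have X: "?X \<in> carrier R" by (rule group_elem_carrier[OF x])
  have shift: "eval_at x (pCons 0 r) = ?X \<otimes>\<^bsub>R\<^esub> eval_at x r" for r
    using R.m_closed[OF X eval_at_carrier, of r]
    by (simp add: eval_at_pCons[OF x] fun_eq_iff group_ring_add)
  have "eval_at x (pCons a p) \<otimes>\<^bsub>R\<^esub> eval_at x q =
      (\<lambda>g. a * \<one>\<^bsub>R\<^esub> g) \<otimes>\<^bsub>R\<^esub> eval_at x q \<oplus>\<^bsub>R\<^esub> (?X \<otimes>\<^bsub>R\<^esub> eval_at x p) \<otimes>\<^bsub>R\<^esub> eval_at x q"
    by (simp add: eval_at_pCons[OF x] R.l_distr scale_carrier X eval_at_carrier)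
  also have "(\<lambda>g. a * \<one>\<^bsub>R\<^esub> g) \<otimes>\<^bsub>R\<^esub> eval_at x q = eval_at x (smult a q)"
    using scale_mult(1)[OF R.one_closed eval_at_carrier, of a q]
    by (simp add: eval_at_smult eval_at_carrier)
  also have "(?X \<otimes>\<^bsub>R\<^esub> eval_at x p) \<otimes>\<^bsub>R\<^esub> eval_at x q = eval_at x (pCons 0 (p * q))"
    by (simp add: shift pCons(2) R.m_assoc X eval_at_carrier)
  finally show ?case by (simp add: eval_at_add)
qed

lemma eval_at_1: "eval_at x 1 = \<one>\<^bsub>R\<^esub>"
proof -
  have "eval_at x (pCons 1 0) = \<one>\<^bsub>R\<^esub>"
    by (simp add: eval_at_pCons[OF x] eval_at_0 group_elem_carrier x)
  then show ?thesis by (simp add: one_pCons)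
qed

lemma eval_at_T: "eval_at x [:0, 1:] = group_elem x"
  using eval_at_1 group_elem_carrier[OF x]
  by (simp add: eval_at_pCons[OF x, of 0] one_pCons) (simp add: fun_eq_iff group_ring_add)

lemma eval_at_power: "eval_at x (p ^ n) = eval_at x p [^]\<^bsub>R\<^esub> n"
  by (induction n)
     (simp_all add: eval_at_1 eval_at_mult power_Suc2 del: power_Suc)

lemma eval_at_T_power: "eval_at x ([:0, 1:] ^ n) = group_elem (x [^] n)"
proof -
  have "group_elem x [^]\<^bsub>R\<^esub> n = group_elem (x [^] n)"
    by (induction n) (simp_all add: group_ring_one group_elem_mult)
  then show ?thesis by (simp add: eval_at_power eval_at_T)
qed

lemma eval_at_geometric: "eval_at x (\<Sum>i<k. [:0, 1:] ^ i) = geom_elem G x k"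
proof (induction k)
  case (Suc k)
  have "geom_elem G x (Suc k) = group_elem (x [^] k) \<oplus>\<^bsub>R\<^esub> geom_elem G x k"
    unfolding geom_elem_def lessThan_Suc by (rule R.finsum_insert) (auto simp: group_elem_carrier x)
  then show ?case
    using Suc by (simp add: eval_at_add eval_at_T_power fun_eq_iff group_ring_add)
qed (simp add: geom_elem_def eval_at_0)

text \<open>Evaluation at \<open>x\<close> only depends on the polynomial modulo \<open>T ^ d - 1\<close>, where \<open>x ^ d = 1\<close>.\<close>

lemma eval_at_cong:
  assumes "x [^] (d :: nat) = \<one>" "[:0, 1:] ^ d - 1 dvd p - q"
  shows "eval_at x p = eval_at x q"
proof -
  let ?T = "[:0, 1:] :: int poly"
  obtain r where "p - q = (?T ^ d - 1) * r" using assms(2) by (rule dvdE)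
  then have eq: "p + r = q + ?T ^ d * r" by (simp add: algebra_simps)
  have "eval_at x (?T ^ d * r) = eval_at x r"
    by (simp add: eval_at_mult eval_at_T_power assms(1) eval_at_carrier flip: group_ring_one)
  then have "eval_at x p \<oplus>\<^bsub>R\<^esub> eval_at x r = eval_at x q \<oplus>\<^bsub>R\<^esub> eval_at x r"
    using arg_cong[OF eq, of "eval_at x"] by (simp add: eval_at_add)
  then show ?thesis using eval_at_carrier by simp
qed

end

end

section \<open>Geometric sums of polynomials\<close>

abbreviation T :: "int poly" where "T \<equiv> [:0, 1:]"

definition geom_poly :: "nat \<Rightarrow> int poly" where
  "geom_poly k = (\<Sum>i<k. T ^ i)"

lemma poly_geom_poly_1: "poly (geom_poly k) 1 = int k"
  by (simp add: geom_poly_def poly_sum)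

lemma geom_poly_1: "geom_poly 1 = 1"
  by (simp add: geom_poly_def)

lemma geom_poly_add: "geom_poly (a + b) = geom_poly a + T ^ a * geom_poly b"
  by (induction b) (simp_all add: geom_poly_def power_add algebra_simps)

text \<open>
  \<open>k * l\<close> exponents, sorted by their quotient by \<open>k\<close>.  The second factor is
  \<open>1 + S + \<dots> + S ^ (l - 1)\<close> at \<open>S = T ^ k\<close>.
\<close>

lemma geom_poly_mult: "geom_poly k * (\<Sum>i<l. T ^ (k * i)) = geom_poly (k * l)"
proof (induction l)
  case (Suc l)
  have "geom_poly (k * Suc l) = geom_poly (k * l) + T ^ (k * l) * geom_poly k"
    by (metis geom_poly_add mult_Suc_right add.commute)
  then show ?case using Suc by (simp add: ring_distribs mult.commute)
qed (simp add: geom_poly_def)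

lemma geom_poly_cong_mod: "geom_poly d dvd geom_poly k - geom_poly (k mod d)"
proof -
  have "geom_poly k = geom_poly (k mod d + d * (k div d))" by simp
  also have "\<dots> = geom_poly (k mod d) + T ^ (k mod d) * geom_poly (d * (k div d))"
    by (rule geom_poly_add)
  finally show ?thesis by (simp flip: geom_poly_mult)
qed

lemma T_pow_minus_1: "T ^ d - 1 = (T - 1) * geom_poly d"
  unfolding geom_poly_def by (rule power_diff_1_eq)

lemma dvd_diff_powers:
  fixes a b c :: "'r :: comm_ring_1"
  assumes "c dvd a - b"
  shows "c dvd a ^ n - b ^ n"
  using assms unfolding power_diff_sumr2 by simp

lemma dvd_diff_trans:
  fixes a b c d :: "'r :: comm_ring_1"
  shows "d dvd a - b \<Longrightarrow> d dvd b - c \<Longrightarrow> d dvd a - c"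
  using dvd_add[of d "a - b" "b - c"] by simp

lemma dvd_diff_mult:
  fixes a b a' b' d :: "'r :: comm_ring_1"
  assumes "d dvd a - a'" "d dvd b - b'"
  shows "d dvd a * b - a' * b'"
proof -
  have "a * b - a' * b' = (a - a') * b + a' * (b - b')" by (simp add: algebra_simps)
  then show ?thesis using assms by simp
qed

text \<open>
  Since \<open>T ^ d - 1 = (T - 1) (1 + T + \<dots> + T ^ (d - 1))\<close> and the second factor does not vanish at
  \<open>1\<close>, a congruence modulo \<open>T ^ d - 1\<close> may be checked modulo the geometric sum and at \<open>1\<close>.  The
  geometric sum kills the correction term of a Bass unit, and evaluation at \<open>1\<close> is the
  augmentation.
\<close>

lemma T_pow_minus_1_dvd:
  assumes "0 < d" "geom_poly d dvd p" "poly p 1 = 0"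
  shows "T ^ d - 1 dvd p"
proof -
  obtain r where r: "p = geom_poly d * r" using assms(2) by (rule dvdE)
  have "poly r 1 = 0" using assms(1,3) by (simp add: r poly_geom_poly_1)
  then have "[:- 1, 1:] dvd r" by (simp only: poly_eq_0_iff_dvd)
  moreover have "[:- 1, 1:] = T - 1" by (simp add: one_pCons)
  ultimately show ?thesis unfolding r T_pow_minus_1 by (simp add: mult.commute mult_dvd_mono)
qed

section \<open>Bass cyclic units\<close>

text \<open>
  The polynomial whose value at a group element of order \<open>d\<close> is the Bass cyclic unit with
  parameters \<open>k\<close> and \<open>m\<close>.
\<close>

definition bass_poly :: "nat \<Rightarrow> nat \<Rightarrow> nat \<Rightarrow> int poly" where
  "bass_poly d k m = geom_poly k ^ m + smult ((1 - int k ^ m) div int d) (geom_poly d)"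

lemma bass_correction:
  assumes "coprime k d" "totient d dvd m" 
  shows "int k ^ m + (1 - int k ^ m) div int d * int d = 1"
proof -
  obtain r where r: "m = totient d * r" using assms(2) by (rule dvdE)
  have "[k ^ totient d = 1] (mod d)" using assms(1) by (rule euler_theorem)
  then have "[k ^ m = 1] (mod d)" unfolding r power_mult using cong_pow by fastforce
  then have "[int k ^ m = 1] (mod int d)" by (metis cong_int_iff of_nat_1 of_nat_power)
  then have "int d dvd 1 - int k ^ m" by (metis cong_iff_dvd_diff cong_sym)
  then show ?thesis by simp
qed

lemma poly_bass_poly_1:
  assumes "coprime k d" "totient d dvd m"
  shows "poly (bass_poly d k m) 1 = 1"
  using bass_correction[OF assms] by (simp add: bass_poly_def poly_geom_poly_1)

lemma bass_poly_cong: "geom_poly d dvd bass_poly d k m - geom_poly k ^ m"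
  by (simp add: bass_poly_def dvd_smult)

text \<open>
  If \<open>l\<close> inverts \<open>k\<close> modulo \<open>d\<close>, the inverse is the Bass unit of \<open>T ^ k\<close> with parameters \<open>l\<close> and
  \<open>m\<close>: the product of the two geometric sums has \<open>k * l\<close> terms, and these add up to \<open>1\<close> modulo
  a full period.
\<close>

lemma bass_poly_inverse:
  assumes "0 < d" "coprime k d" "totient d dvd m"
  shows "\<exists>q. T ^ d - 1 dvd bass_poly d k m * q - 1"
proof -
  obtain l where l: "[k * l = 1] (mod d)" using assms(2) coprime_iff_invertible_nat by auto
  then have "coprime l d"
    by (metis cong_imp_coprime cong_sym coprime_1_left coprime_mult_left_iff)
  define s where "s = (\<Sum>i<l. T ^ (k * i))"
  define q where "q = s ^ m + smult ((1 - int l ^ m) div int d) (geom_poly d)"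
  have "poly q 1 = 1"
    using bass_correction[OF \<open>coprime l d\<close> assms(3)]
    by (simp add: q_def s_def poly_geom_poly_1 poly_sum)
  then have "poly (bass_poly d k m * q - 1) 1 = 0"
    using poly_bass_poly_1[OF assms(2,3)] by simp
  moreover have "geom_poly d dvd bass_poly d k m * q - 1"
  proof (rule dvd_diff_trans)
    have "geom_poly d dvd q - s ^ m" by (simp add: q_def dvd_smult)
    with bass_poly_cong show "geom_poly d dvd bass_poly d k m * q - geom_poly k ^ m * s ^ m"
      by (rule dvd_diff_mult)
    have "geom_poly d dvd geom_poly (k * l) - 1"
    proof (cases "d = 1")
      case False
      with assms(1) l have "(k * l) mod d = 1" by (simp add: cong_def)
      then show ?thesis using geom_poly_cong_mod[of d "k * l"] by (simp add: geom_poly_def)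
    qed (simp add: geom_poly_def)
    then have "geom_poly d dvd geom_poly (k * l) ^ m - 1 ^ m" by (rule dvd_diff_powers)
    then show "geom_poly d dvd geom_poly k ^ m * s ^ m - 1"
      by (simp add: s_def geom_poly_mult flip: power_mult_distrib)
  qed
  ultimately show ?thesis using T_pow_minus_1_dvd[OF assms(1)] by blast
qed

lemma geom_poly_dvd_power_d: "geom_poly d dvd T ^ d - 1"
  unfolding T_pow_minus_1 by simp

lemma coprime_small_order:
  assumes "d \<in> {1, 2, 3, 4, 6 :: nat}" "coprime k d"
  shows "d = 1 \<or> k mod d = 1 \<or> 2 < d \<and> k mod d = d - 1"
proof -
  have not_dvd: "\<not> p dvd k" if "p dvd d" "p \<noteq> 1" for p
    using assms(2) that by (metis coprime_common_divisor_nat)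
  consider "d = 1" | "d = 2" | "d = 3" | "d = 4" | "d = 6" using assms(1) by blast
  then show ?thesis
  proof cases
    case 2
    then have "\<not> 2 dvd k" by (intro not_dvd) simp_all
    then show ?thesis unfolding 2 by presburger
  next
    case 3
    then have "\<not> 3 dvd k" by (intro not_dvd) simp_all
    then show ?thesis unfolding 3 by presburger
  next
    case 4
    then have "\<not> 2 dvd k" by (intro not_dvd) simp_all
    then show ?thesis unfolding 4 by presburger
  next
    case 5
    then have "\<not> 2 dvd k" "\<not> 3 dvd k" by (intro not_dvd; simp)+
    then show ?thesis unfolding 5 by presburger
  qed simp
qed

lemma even_power_neg_power:
  fixes t :: "'r :: comm_ring_1"
  assumes "even m"
  shows "((- (t ^ c)) ^ m) ^ d = (t ^ d) ^ (c * m)"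
proof -
  have "((- (t ^ c)) ^ m) ^ d = ((t ^ c) ^ m) ^ d" using assms by simp
  also have "\<dots> = t ^ (d * (c * m))" by (simp only: power_mult[symmetric] ac_simps)
  finally show ?thesis by (simp only: power_mult)
qed

text \<open>
  In these orders \<open>k\<close> is \<open>1\<close> or \<open>- 1\<close> modulo \<open>d\<close>, and modulo a full period \<open>k\<close> consecutive powers
  of \<open>T\<close> add up to \<open>1\<close> or to \<open>- T ^ (d - 1)\<close>.  In the second case \<open>d > 2\<close>, so \<open>totient d\<close> is
  even and the sign disappears in the \<open>m\<close>-th power.
\<close>

lemma bass_poly_torsion:
  assumes "d \<in> {1, 2, 3, 4, 6}" "coprime k d" "totient d dvd m"
  shows "T ^ d - 1 dvd bass_poly d k m ^ d - 1"
proof (rule T_pow_minus_1_dvd)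
  show d: "0 < d" using assms(1) by auto
  show "poly (bass_poly d k m ^ d - 1) 1 = 0" using poly_bass_poly_1[OF assms(2,3)] by simp
  obtain a where a: "geom_poly d dvd geom_poly k - a" "geom_poly d dvd (a ^ m) ^ d - 1"
  proof (cases "d = 1 \<or> k mod d = 1")
    case True
    then have "geom_poly d dvd geom_poly k - 1"
      using geom_poly_cong_mod[of d k] by (metis geom_poly_1 one_dvd)
    then show ?thesis using that[of 1] by simp
  next
    case False
    then have k: "2 < d" "k mod d = d - 1" using coprime_small_order[OF assms(1,2)] by auto
    then have "even m" using totient_even[of d] assms(3) by (meson dvd_trans)
    \<comment> \<open>A full period lacking its last term is minus that term.\<close>
    have "geom_poly d = geom_poly (d - 1) + T ^ (d - 1)"
      using geom_poly_add[of "d - 1" 1] d by (simp only: geom_poly_1 mult_1_right) simp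
    then have "geom_poly (d - 1) - (- (T ^ (d - 1))) = geom_poly d" by simp
    then have "geom_poly d dvd geom_poly (d - 1) - (- (T ^ (d - 1)))" by simp
    then have "geom_poly d dvd geom_poly k - (- (T ^ (d - 1)))"
      using geom_poly_cong_mod[of d k] unfolding k(2) by (rule dvd_diff_trans[rotated])
    moreover have "geom_poly d dvd (T ^ d) ^ ((d - 1) * m) - 1 ^ ((d - 1) * m)"
      by (intro dvd_diff_powers geom_poly_dvd_power_d)
    then have "geom_poly d dvd ((- (T ^ (d - 1))) ^ m) ^ d - 1"
      using \<open>even m\<close> by (simp only: even_power_neg_power power_one)
    ultimately show ?thesis by (rule that)
  qed
  have "geom_poly d dvd bass_poly d k m ^ d - (geom_poly k ^ m) ^ d"
    by (intro dvd_diff_powers bass_poly_cong)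
  moreover have "geom_poly d dvd (geom_poly k ^ m) ^ d - (a ^ m) ^ d"
    by (intro dvd_diff_powers a(1))
  ultimately show "geom_poly d dvd bass_poly d k m ^ d - 1"
    using a(2) by (meson dvd_diff_trans)
qed

context finite_group
begin

lemma ord_pos: "x \<in> carrier G \<Longrightarrow> 0 < ord x"
  using finite_carrier ord_ge_1 by (simp add: Suc_le_eq)

lemma bass_unit_eq_eval:
  assumes "x \<in> carrier G"
  shows "bass_unit G k m x = eval_at x (bass_poly (ord x) k m)"
  using assms
  by (simp add: bass_unit_def bass_poly_def Let_def geom_poly_def eval_at_add eval_at_power
      eval_at_smult add_pow_eq_scale eval_at_carrier flip: eval_at_geometric)

lemma bass_unit_in_Units:
  assumes "x \<in> carrier G" "coprime k (ord x)" "totient (ord x) dvd m"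
  shows "bass_unit G k m x \<in> Units R"
proof -
  let ?p = "bass_poly (ord x) k m"
  obtain q where q: "T ^ ord x - 1 dvd ?p * q - 1"
    using bass_poly_inverse[OF ord_pos[OF assms(1)] assms(2,3)] by blast
  have "eval_at x (?p * q) = \<one>\<^bsub>R\<^esub>"
    using eval_at_cong[OF assms(1) _ q] assms(1) by (simp add: eval_at_1)
  then have "eval_at x ?p \<otimes>\<^bsub>R\<^esub> eval_at x q = \<one>\<^bsub>R\<^esub>" "eval_at x q \<otimes>\<^bsub>R\<^esub> eval_at x ?p = \<one>\<^bsub>R\<^esub>"
    using assms(1) by (simp_all add: mult.commute flip: eval_at_mult)
  then show ?thesis
    unfolding Units_def bass_unit_eq_eval[OF assms(1)] using eval_at_carrier[OF assms(1)] by blast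
qed

lemma bass_unit_torsion:
  assumes "x \<in> carrier G" "ord x \<in> {1, 2, 3, 4, 6}" "coprime k (ord x)" "totient (ord x) dvd m"
  shows "bass_unit G k m x [^]\<^bsub>R\<^esub> ord x = \<one>\<^bsub>R\<^esub>"
  using eval_at_cong[OF assms(1) _ bass_poly_torsion[OF assms(2-4)]] assms(1)
  by (simp add: bass_unit_eq_eval eval_at_1 flip: eval_at_power)

lemma units_of_nat_pow:
  "u [^]\<^bsub>units_of R\<^esub> (n :: nat) = u [^]\<^bsub>R\<^esub> n"
  by (induction n) (simp_all add: units_of_one units_of_mult)

lemma no_free_pair_with_bass_unit:
  assumes "\<And>x. x \<in> carrier G \<Longrightarrow> ord x \<in> {1, 2, 3, 4, 6}" "u \<in> bass_cyclic_units G"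
  shows "\<not> free_pair (units_of R) b u"
proof
  assume free: "free_pair (units_of R) b u"
  obtain k m x where x: "u = bass_unit G k m x" "x \<in> carrier G" "coprime k (ord x)"
      "totient (ord x) dvd m"
    using assms(2) unfolding bass_cyclic_units_def by blast
  interpret U: group "units_of R" by (rule R.units_group)
  have "u [^]\<^bsub>units_of R\<^esub> ord x \<noteq> \<one>\<^bsub>units_of R\<^esub>"
    using U.free_pair_no_torsion[OF free] ord_pos x(2) by blast
  moreover have "u [^]\<^bsub>units_of R\<^esub> ord x = \<one>\<^bsub>units_of R\<^esub>"
    using bass_unit_torsion assms(1) x by (simp add: units_of_nat_pow units_of_one)
  ultimately show False by simp
qed

text \<open>
  The two factors \<open>1 + h + \<dots> + h ^ (d - 1)\<close> and \<open>1 - h\<close> annihilate each other, so a bicyclic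
  unit is \<open>1 + \<tau>\<close> with \<open>\<tau>\<^sup>2 = 0\<close>.
\<close>

lemma bicyclic_in_Units:
  assumes "x \<in> carrier G" "h \<in> carrier G"
  shows "\<one>\<^bsub>R\<^esub> \<oplus>\<^bsub>R\<^esub> (\<one>\<^bsub>R\<^esub> \<ominus>\<^bsub>R\<^esub> group_elem h) \<otimes>\<^bsub>R\<^esub> group_elem x \<otimes>\<^bsub>R\<^esub> geom_elem G h (ord h) \<in> Units R"
proof -
  define e where "e = \<one>\<^bsub>R\<^esub> \<ominus>\<^bsub>R\<^esub> group_elem h"
  define N where "N = geom_elem G h (ord h)"
  define t where "t = e \<otimes>\<^bsub>R\<^esub> group_elem x \<otimes>\<^bsub>R\<^esub> N"
  have X: "group_elem x \<in> carrier R" "group_elem h \<in> carrier R"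
    using assms by (simp_all add: group_elem_carrier)
  have N: "N = eval_at h (geom_poly (ord h))"
    by (simp add: N_def eval_at_geometric assms geom_poly_def)
  have carr: "e \<in> carrier R" "N \<in> carrier R" "t \<in> carrier R"
    using X eval_at_carrier[OF assms(2)] by (auto simp: e_def t_def N)
  have "N \<otimes>\<^bsub>R\<^esub> group_elem h = eval_at h (geom_poly (ord h) * T)"
    by (simp add: N eval_at_T assms(2) eval_at_mult del: mult_pCons_right)
  also have "\<dots> = N"
  proof -
    have "geom_poly (ord h) * T - geom_poly (ord h) = T ^ ord h - 1"
      unfolding T_pow_minus_1 by (simp only: right_diff_distrib left_diff_distrib mult_1 mult_1_right mult.commute)
    then show ?thesis
      unfolding N by (intro eval_at_cong[OF assms(2) pow_ord_eq_1[OF assms(2)]]) simp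
  qed
  finally have Nh: "N \<otimes>\<^bsub>R\<^esub> group_elem h = N" .
  have "N \<otimes>\<^bsub>R\<^esub> e = \<zero>\<^bsub>R\<^esub>"
    using carr X Nh by (simp add: e_def a_minus_def R.r_distr R.r_minus R.r_neg)
  then have "N \<otimes>\<^bsub>R\<^esub> t = \<zero>\<^bsub>R\<^esub>"
    using carr X by (simp add: t_def flip: R.m_assoc)
  then have tt: "t \<otimes>\<^bsub>R\<^esub> t = \<zero>\<^bsub>R\<^esub>"
    using carr X by (subst (1) t_def) (simp add: R.m_assoc)
  have inverse: "(\<one>\<^bsub>R\<^esub> \<oplus>\<^bsub>R\<^esub> t) \<otimes>\<^bsub>R\<^esub> (\<one>\<^bsub>R\<^esub> \<ominus>\<^bsub>R\<^esub> t) = \<one>\<^bsub>R\<^esub>" "(\<one>\<^bsub>R\<^esub> \<ominus>\<^bsub>R\<^esub> t) \<otimes>\<^bsub>R\<^esub> (\<one>\<^bsub>R\<^esub> \<oplus>\<^bsub>R\<^esub> t) = \<one>\<^bsub>R\<^esub>"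
    using carr tt by (simp_all add: a_minus_def R.r_distr R.l_distr R.r_minus R.l_minus
        R.a_assoc R.r_neg R.l_neg)
  have "\<one>\<^bsub>R\<^esub> \<oplus>\<^bsub>R\<^esub> t \<in> carrier R" "\<one>\<^bsub>R\<^esub> \<ominus>\<^bsub>R\<^esub> t \<in> carrier R" using carr by simp_all
  with inverse have "\<one>\<^bsub>R\<^esub> \<oplus>\<^bsub>R\<^esub> t \<in> Units R" unfolding Units_def by blast
  then show ?thesis by (simp only: t_def e_def N_def)
qed

end

section \<open>Groups of permutations acting on functions\<close>

locale permutation_group = finite_group G for G :: "(nat \<Rightarrow> nat) monoid" (structure) +
  assumes mult_comp: "monoid.mult G = (\<circ>)" and one_id: "one G = id"
    and bij: "p \<in> carrier G \<Longrightarrow> bij p"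
begin

text \<open>
  The permutation representation, in which \<open>p\<close> carries the indicator function of \<open>j\<close> to that of
  \<open>p j\<close>.  The inverse makes it a left action.
\<close>

definition act :: "((nat \<Rightarrow> nat) \<Rightarrow> int) \<Rightarrow> (nat \<Rightarrow> int) \<Rightarrow> nat \<Rightarrow> int" where
  "act f v i = lin (\<lambda>p. v (inv' p i)) f"

lemma act_mult:
  assumes "f \<in> carrier R" "k \<in> carrier R"
  shows "act (f \<otimes>\<^bsub>R\<^esub> k) v = act f (act k v)"
proof
  fix i
  have "lin (\<lambda>q. v (inv' (p \<otimes> q) i)) k = lin (\<lambda>q. v (inv' q (inv' p i))) k"
    if "p \<in> carrier G" for p
    using that unfolding lin_def mult_comp
    by (intro sum.cong refl) (simp add: o_inv_distrib bij)
  then have "lin (\<lambda>p. lin (\<lambda>q. v (inv' (p \<otimes> q) i)) k) f = lin (\<lambda>p. lin (\<lambda>q. v (inv' q (inv' p i))) k) f"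
    unfolding lin_def[of _ f] by (intro sum.cong refl) simp
  then show "act (f \<otimes>\<^bsub>R\<^esub> k) v i = act f (act k v) i"
    using assms by (simp add: act_def lin_mult)
qed

lemma act_add: "act (f \<oplus>\<^bsub>R\<^esub> k) v = (\<lambda>i. act f v i + act k v i)"
  by (simp add: act_def fun_eq_iff lin_add)

lemma act_minus:
  "f \<in> carrier R \<Longrightarrow> k \<in> carrier R \<Longrightarrow> act (f \<ominus>\<^bsub>R\<^esub> k) v = (\<lambda>i. act f v i - act k v i)"
  by (simp add: act_def fun_eq_iff lin_minus)

lemma act_group_elem: "p \<in> carrier G \<Longrightarrow> act (group_elem p) v = v \<circ> inv' p"
  by (simp add: act_def lin_group_elem fun_eq_iff)

lemma act_one: "act \<one>\<^bsub>R\<^esub> v = v"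
  unfolding group_ring_one act_group_elem[OF one_closed] by (simp add: one_id)

lemma act_unit_inv:
  assumes "a \<in> Units R" "act a v = w"
  shows "act (inv\<^bsub>units_of R\<^esub> a) w = v"
proof -
  have "inv\<^bsub>units_of R\<^esub> a = inv\<^bsub>R\<^esub> a" by (rule R.units_of_inv[OF assms(1)])
  then have "act (inv\<^bsub>units_of R\<^esub> a) w = act (inv\<^bsub>R\<^esub> a \<otimes>\<^bsub>R\<^esub> a) v"
    unfolding assms(2)[symmetric] using assms(1)
    by (simp add: R.Units_closed R.Units_inv_closed flip: act_mult)
  then show ?thesis using assms(1) by (simp add: R.Units_l_inv act_one)
qed

lemma act_eval_at_T_power:
  assumes "p \<in> carrier G"
  shows "act (eval_at p (T ^ n)) v = v \<circ> (inv' p ^^ n)"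
proof (induction n arbitrary: v)
  case 0
  show ?case using assms by (simp add: eval_at_1 act_one)
next
  case (Suc n)
  have "act (eval_at p (T ^ Suc n)) v = act (group_elem p) (act (eval_at p (T ^ n)) v)"
    using assms by (simp only: power_Suc eval_at_mult eval_at_T act_mult group_elem_carrier eval_at_carrier)
  then show ?case using Suc assms by (simp add: act_group_elem fun_eq_iff funpow_swap1)
qed

lemma act_eval_at_add:
  "p \<in> carrier G \<Longrightarrow> act (eval_at p (a + b)) v = (\<lambda>i. act (eval_at p a) v i + act (eval_at p b) v i)"
  by (simp add: eval_at_add act_add)

lemma act_eval_at_smult:
  "p \<in> carrier G \<Longrightarrow> act (eval_at p (smult c a)) v = (\<lambda>i. c * act (eval_at p a) v i)"
  by (simp add: eval_at_smult act_def fun_eq_iff lin_scale)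

lemma act_eval_at_power_Suc:
  "p \<in> carrier G \<Longrightarrow> act (eval_at p (a ^ Suc n)) v = act (eval_at p a) (act (eval_at p (a ^ n)) v)"
  by (simp add: eval_at_mult act_mult eval_at_carrier)

lemma geom_elem_eq_eval: "p \<in> carrier G \<Longrightarrow> geom_elem G p k = eval_at p (geom_poly k)"
  by (simp add: eval_at_geometric geom_poly_def)

end

section \<open>A free pair in the alternating group on five letters\<close>

text \<open>
  The element \<open>x0\<close> fixes \<open>4\<close> and \<open>5\<close>, so for a function \<open>v\<close> that \<open>h0\<close> fixes, \<open>x0 v\<close> agrees at \<open>4\<close> and
  \<open>5\<close> and \<open>(1 - h0) x0 v\<close> is a multiple of \<open>\<delta>\<^sub>1 - \<delta>\<^sub>2\<close>.  This is why the bicyclic unit built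
  from \<open>h0\<close> and \<open>x0\<close> is a transvection.
\<close>

definition h0 :: "nat \<Rightarrow> nat" where "h0 = id(1 := 2, 2 := 1, 4 := 5, 5 := 4)"
definition x0 :: "nat \<Rightarrow> nat" where "x0 = id(1 := 3, 3 := 2, 2 := 1)"
definition y0 :: "nat \<Rightarrow> nat" where "y0 = id(1 := 2, 2 := 3, 3 := 4, 4 := 5, 5 := 1)"

lemma inv_h0: "inv' h0 = h0"
  by (rule inv_unique_comp) (auto simp: h0_def fun_eq_iff)

lemma inv_x0: "inv' x0 = id(3 := 1, 2 := 3, 1 := 2)"
  by (rule inv_unique_comp) (auto simp: x0_def fun_eq_iff)

lemma inv_y0: "inv' y0 = id(2 := 1, 3 := 2, 4 := 3, 5 := 4, 1 := 5)"
  by (rule inv_unique_comp) (auto simp: y0_def fun_eq_iff)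

text \<open>
  The function \<open>p w + q (\<sigma> w)\<close>, where \<open>w = \<delta>\<^sub>1 - \<delta>\<^sub>2\<close> and \<open>\<sigma> w = \<delta>\<^sub>5 + \<delta>\<^sub>2 - \<delta>\<^sub>3 - \<delta>\<^sub>1\<close> is the sum
  of its two shifts by the five-cycle.
\<close>

definition vec :: "int \<Rightarrow> int \<Rightarrow> nat \<Rightarrow> int" where
  "vec p q = (\<lambda>_. 0)(1 := p - q, 2 := q - p, 3 := - q, 5 := q)"

lemma vec_eq_iff: "vec p q = vec p' q' \<longleftrightarrow> p = p' \<and> q = q'"
proof
  assume "vec p q = vec p' q'"
  then have "vec p q 5 = vec p' q' 5" "vec p q 1 = vec p' q' 1" by simp_all
  then show "p = p' \<and> q = q'" by (simp add: vec_def)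
qed simp

text \<open>
  Cones of the plane for the four letters, with \<open>True\<close> in front for the cube of the transvection.
  Its cones \<open>\<bar>p\<bar> \<ge> 3 \<bar>q\<bar>\<close> surround the line \<open>q = 0\<close> that it fixes.  The eigenlines of the Fibonacci
  matrix have slopes \<open>p / q\<close> equal to the golden ratio, between \<open>3/2\<close> and \<open>2\<close>, and to
  \<open>- 0.618\<dots>\<close>, between \<open>- 1\<close> and \<open>- 1/2\<close>.  The cube shifts slopes by \<open>6\<close>, and so moves
  the slopes in both of these intervals beyond \<open>\<plusminus> 3\<close>, which a shift by \<open>2\<close> would not do.
\<close>

fun region :: "bool \<times> bool \<Rightarrow> int \<Rightarrow> int \<Rightarrow> bool" where
  "region (True, True) p q \<longleftrightarrow> q > 0 \<and> p \<ge> 3 * q \<or> q < 0 \<and> p \<le> 3 * q"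
| "region (True, False) p q \<longleftrightarrow> q > 0 \<and> p \<le> - 3 * q \<or> q < 0 \<and> p \<ge> - 3 * q"
| "region (False, True) p q \<longleftrightarrow>
    q > 0 \<and> 3 * q \<le> 2 * p \<and> p \<le> 2 * q \<or> q < 0 \<and> 3 * q \<ge> 2 * p \<and> p \<ge> 2 * q"
| "region (False, False) p q \<longleftrightarrow>
    q > 0 \<and> - q \<le> p \<and> 2 * p \<le> - q \<or> q < 0 \<and> - q \<ge> p \<and> 2 * p \<ge> - q"

text \<open>
  The entries \<open>10946\<close>, \<open>6765\<close>, \<open>4181\<close> are the Fibonacci numbers with indices 21, 20, 19.
\<close>

fun letter_map :: "bool \<times> bool \<Rightarrow> int \<Rightarrow> int \<Rightarrow> int \<times> int" where
  "letter_map (True, True) p q = (p + 6 * q, q)"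
| "letter_map (True, False) p q = (p - 6 * q, q)"
| "letter_map (False, True) p q = (10946 * p + 6765 * q, 6765 * p + 4181 * q)"
| "letter_map (False, False) p q = (4181 * p - 6765 * q, 10946 * q - 6765 * p)"

lemma region_step:
  assumes "\<not> cancelling l l'" "region l' p q"
  shows "case_prod (region l) (letter_map l p q)"
proof (cases l)
  case l: (Pair i e)
  show ?thesis
  proof (cases l')
    case (Pair i' e')
    then show ?thesis using assms l
      by (cases i; cases e; cases i'; cases e') (auto simp: cancelling_def)
  qed
qed

text \<open>
  The base point \<open>(1, 1)\<close> has slope \<open>1\<close>, below the golden cone \<open>3/2 \<le> p / q \<le> 2\<close>.
\<close>

lemma region_base:
  "case_prod (region l) (letter_map l 1 1)" "\<not> region l (1 :: int) 1"
  by (cases l; cases "fst l"; cases "snd l"; auto)+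

lemma region_disjoint: "region l p q \<Longrightarrow> region l' p q \<Longrightarrow> l = l'"
  by (cases l; cases l'; cases "fst l"; cases "snd l"; cases "fst l'"; cases "snd l'"; auto)

locale five_letters = permutation_group +
  assumes h0: "h0 \<in> carrier G" and x0: "x0 \<in> carrier G" and y0: "y0 \<in> carrier G"
begin

lemma ord_prime:
  assumes "p \<in> carrier G" "Factorial_Ring.prime n" "p [^] n = \<one>" "p \<noteq> \<one>"
  shows "ord p = n"
proof -
  have "ord p dvd n" using assms(1,3) by (simp add: pow_eq_id)
  then have "ord p = 1 \<or> ord p = n" using assms(2) by (simp add: prime_nat_iff)
  then show ?thesis using ord_eq_1[OF assms(1)] assms(4) by argo
qed

lemma ord_h0: "ord h0 = 2"
proof (rule ord_prime[OF h0])
  show "h0 [^] (2 :: nat) = \<one>"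
    by (simp add: numeral_2_eq_2 mult_comp one_id) (auto simp: h0_def fun_eq_iff)
  have "h0 1 \<noteq> id 1" by (simp add: h0_def)
  then show "h0 \<noteq> \<one>" unfolding one_id by metis
qed simp

lemma ord_y0: "ord y0 = 5"
proof (rule ord_prime[OF y0])
  show "y0 [^] (5 :: nat) = \<one>"
    by (simp add: eval_nat_numeral mult_comp one_id) (auto simp: y0_def fun_eq_iff)
  have "y0 1 \<noteq> id 1" by (simp add: y0_def)
  then show "y0 \<noteq> \<one>" unfolding one_id by metis
qed simp

definition b0 where
  "b0 = \<one>\<^bsub>R\<^esub> \<oplus>\<^bsub>R\<^esub> (\<one>\<^bsub>R\<^esub> \<ominus>\<^bsub>R\<^esub> group_elem h0) \<otimes>\<^bsub>R\<^esub> group_elem x0 \<otimes>\<^bsub>R\<^esub> geom_elem G h0 (ord h0)"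

text \<open>
  The exponent \<open>20\<close> is a multiple of \<open>totient 5\<close>, as a Bass unit requires, and of the order of
  \<open>y0\<close>.
\<close>

definition u0 where "u0 = bass_unit G 3 20 y0"

lemma b0_bicyclic: "b0 \<in> bicyclic_units G"
  unfolding bicyclic_units_def b0_def Let_def using h0 x0 by blast

lemma totient_5: "totient 5 = 4"
  by (subst totient_prime) simp_all

lemma coprime_3_5: "coprime 3 (5 :: nat)"
  by (rule primes_coprime) simp_all

lemma u0_bass: "u0 \<in> bass_cyclic_units G"
  unfolding bass_cyclic_units_def u0_def using y0
  by (intro CollectI exI[of _ 3] exI[of _ 20] exI[of _ y0])
     (simp add: ord_y0 totient_5 coprime_3_5)

lemma b0_unit: "b0 \<in> Units R"
  unfolding b0_def by (rule bicyclic_in_Units[OF x0 h0])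

lemma u0_unit: "u0 \<in> Units R"
  unfolding u0_def by (rule bass_unit_in_Units[OF y0]) (simp_all add: ord_y0 totient_5 coprime_3_5)

lemma nat_five_cases:
  fixes i :: nat
  obtains "i = 1" | "i = 2" | "i = 3" | "i = 4" | "i = 5" | "i \<notin> {1, 2, 3, 4, 5}"
  by auto

lemma act_b0: "act b0 (vec p q) = vec (p + 2 * q) q"
proof -
  have geom: "act (geom_elem G h0 (ord h0)) v = (\<lambda>i. v i + v (h0 i))" for v
    unfolding ord_h0 geom_elem_eq_eval[OF h0] geom_poly_def
    by (simp add: numeral_2_eq_2 act_eval_at_add h0 act_eval_at_T_power inv_h0 eval_at_1 act_one
      eval_at_T act_group_elem)
  have carr: "group_elem h0 \<in> carrier R" "group_elem x0 \<in> carrier R"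
      "geom_elem G h0 (ord h0) \<in> carrier R"
    using h0 x0 by (simp_all add: group_elem_carrier geom_elem_eq_eval eval_at_carrier)
  define v where "v = (\<lambda>i. vec p q i + vec p q (h0 i)) \<circ> inv' x0"
  have "act b0 (vec p q) = (\<lambda>i. vec p q i + (v i - v (h0 i)))"
    using carr unfolding b0_def v_def
    by (simp add: act_add act_one act_mult act_minus act_group_elem h0 x0 inv_h0 geom)
  also have "\<dots> = vec (p + 2 * q) q"
  proof
    fix i :: nat
    show "vec p q i + (v i - v (h0 i)) = vec (p + 2 * q) q i"
      by (cases i rule: nat_five_cases) (simp_all add: v_def inv_x0 h0_def vec_def)
  qed
  finally show ?thesis .
qed

text \<open>
  The polynomial represents \<open>1 + \<sigma>\<close>, as \<open>y ^ 4\<close> is the inverse of \<open>y\<close>.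
\<close>

lemma act_sigma: "act (eval_at y0 (1 + T + T ^ 4)) (vec p q) = vec (p + q) p"
proof -
  have "act (eval_at y0 (1 + T + T ^ 4)) (vec p q) =
      (\<lambda>i. vec p q i + vec p q (inv' y0 i) + vec p q ((inv' y0 ^^ 4) i))"
    using act_eval_at_T_power[OF y0, of 4 "vec p q"]
    by (simp only: act_eval_at_add[OF y0] eval_at_1[OF y0] act_one eval_at_T[OF y0]
        act_group_elem[OF y0] o_def)
  also have "\<dots> = vec (p + q) p"
  proof
    fix i :: nat
    show "vec p q i + vec p q (inv' y0 i) + vec p q ((inv' y0 ^^ 4) i) = vec (p + q) p i"
      by (cases i rule: nat_five_cases) (simp_all add: inv_y0 eval_nat_numeral vec_def)
  qed
  finally show ?thesis .
qed

lemma act_sigma_power: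
  "act (eval_at y0 ((1 + T + T ^ 4) ^ n)) (vec p q) =
    vec (int (fib (n + 1)) * p + int (fib n) * q)
      (int (fib n) * p + (int (fib (n + 1)) - int (fib n)) * q)"
proof (induction n)
  case 0
  show ?case by (simp add: eval_at_1 y0 act_one)
next
  case (Suc n)
  show ?case unfolding act_eval_at_power_Suc[OF y0] Suc act_sigma vec_eq_iff
    by (simp add: algebra_simps)
qed

lemma act_geom_5: "act (eval_at y0 (geom_poly 5)) (vec p q) = (\<lambda>_. 0)"
proof -
  have "act (eval_at y0 (geom_poly 5)) (vec p q) = (\<lambda>i. \<Sum>j<5. vec p q ((inv' y0 ^^ j) i))"
  proof -
    have "act (eval_at y0 (geom_poly k)) (vec p q) = (\<lambda>i. \<Sum>j<k. vec p q ((inv' y0 ^^ j) i))" for k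
    proof (induction k)
      case 0
      show ?case by (simp add: geom_poly_def eval_at_0 act_def lin_zero)
    next
      case (Suc k)
      have "geom_poly (Suc k) = geom_poly k + T ^ k" by (simp add: geom_poly_def)
      then show ?case
        using Suc by (simp only: act_eval_at_add[OF y0] act_eval_at_T_power[OF y0]) simp
    qed
    then show ?thesis .
  qed
  also have "\<dots> = (\<lambda>_. 0)"
  proof
    fix i :: nat
    show "(\<Sum>j<5. vec p q ((inv' y0 ^^ j) i)) = 0"
      by (cases i rule: nat_five_cases) (simp_all add: inv_y0 eval_nat_numeral vec_def)
  qed
  finally show ?thesis .
qed


text \<open>
  Modulo \<open>T ^ 5 - 1\<close>, the sum \<open>1 + T + T\<^sup>2\<close> is \<open>T (1 + T + T\<^sup>4)\<close>, and the factor \<open>T\<close> disappears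
  in the 20th power.  This replaces a polynomial that does not preserve the plane by one that
  does.
\<close>

lemma u0_eq: "u0 = eval_at y0 ((1 + T + T ^ 4) ^ 20 + smult ((1 - 3 ^ 20) div 5) (geom_poly 5))"
  unfolding u0_def bass_unit_eq_eval[OF y0] ord_y0 bass_poly_def
proof (rule eval_at_cong[OF y0, of 5])
  show "y0 [^] (5 :: nat) = \<one>" using pow_ord_eq_1[OF y0] by (simp add: ord_y0)
  define s where "s = 1 + T + T ^ 4"
  have "geom_poly 3 - T * s = - (T ^ 5 - 1)"
    unfolding geom_poly_def s_def
    by (simp only: sum.lessThan_Suc eval_nat_numeral lessThan_0 sum.empty power_Suc power_0
        algebra_simps) (simp add: algebra_simps)
  then have "T ^ 5 - 1 dvd geom_poly 3 - T * s" by (metis dvd_minus_iff dvd_refl)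
  then have "T ^ 5 - 1 dvd geom_poly 3 ^ 20 - (T * s) ^ 20" by (rule dvd_diff_powers)
  moreover have "T ^ 5 - 1 dvd (T * s) ^ 20 - s ^ 20"
  proof -
    have "T ^ 5 - 1 dvd (T ^ 5) ^ 4 - 1 ^ 4" by (intro dvd_diff_powers dvd_refl)
    moreover have "(T ^ 5) ^ 4 = T ^ 20" by (simp only: power_mult[symmetric]) simp
    moreover have "(T * s) ^ 20 - s ^ 20 = (T ^ 20 - 1) * s ^ 20"
      by (simp only: power_mult_distrib left_diff_distrib mult_1)
    ultimately show ?thesis by (metis dvd_mult2 power_one)
  qed
  ultimately have "T ^ 5 - 1 dvd geom_poly 3 ^ 20 - s ^ 20" by (rule dvd_diff_trans)
  then show "T ^ 5 - 1 dvd
      geom_poly 3 ^ 20 + smult ((1 - int 3 ^ 20) div int 5) (geom_poly 5) -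
      (s ^ 20 + smult ((1 - 3 ^ 20) div 5) (geom_poly 5))"
    by (simp only: of_nat_numeral add_diff_cancel_right)
qed

lemma act_u0: "act u0 (vec p q) = vec (10946 * p + 6765 * q) (6765 * p + 4181 * q)"
proof -
  have fib: "fib (20 + 1) = 10946" "fib 20 = 6765" by (simp_all add: eval_nat_numeral)
  have "act u0 (vec p q) = act (eval_at y0 ((1 + T + T ^ 4) ^ 20)) (vec p q)"
    unfolding u0_eq act_eval_at_add[OF y0] act_eval_at_smult[OF y0] act_geom_5 by simp
  then show ?thesis unfolding act_sigma_power fib by simp
qed

lemma free_pair_b0_u0: "free_pair (units_of R) (b0 [^]\<^bsub>units_of R\<^esub> (3 :: int)) u0"
proof -
  interpret U: group "units_of R" by (rule R.units_group)
  define B where "B = b0 [^]\<^bsub>units_of R\<^esub> (3 :: int)"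
  have B: "B = b0 \<otimes>\<^bsub>R\<^esub> b0 \<otimes>\<^bsub>R\<^esub> b0"
  proof -
    have "B = b0 [^]\<^bsub>units_of R\<^esub> (3 :: nat)"
      unfolding B_def using int_pow_int[of "units_of R" b0 3] by (simp only: of_nat_numeral)
    also have "\<dots> = b0 [^]\<^bsub>R\<^esub> Suc (Suc (Suc 0))"
      by (simp only: units_of_nat_pow numeral_3_eq_3)
    also have "\<dots> = b0 \<otimes>\<^bsub>R\<^esub> b0 \<otimes>\<^bsub>R\<^esub> b0" using R.Units_closed[OF b0_unit] by simp
    finally show ?thesis .
  qed
  have B_unit: "B \<in> Units R" unfolding B using b0_unit by simp
  have act_B: "act B (vec p q) = vec (p + 6 * q) q" for p q
    using b0_unit R.Units_closed by (simp add: B act_mult act_b0 vec_eq_iff)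
  \<comment> \<open>The inverse letters act by the inverse maps, because units act bijectively.\<close>
  have letter: "act (letter_value (units_of R) B u0 l) (vec p q) = case_prod vec (letter_map l p q)"
    for l p q
  proof -
    obtain i e where l: "l = (i, e)" by force
    show ?thesis
      by (cases i; cases e)
         (auto simp: l letter_value_def act_B act_u0 vec_eq_iff
           intro!: act_unit_inv[OF B_unit] act_unit_inv[OF u0_unit])
  qed
  define D where "D l = {v. \<exists>p q. v = vec p q \<and> region l p q}" for l
  have "free_pair (units_of R) B u0"
  proof (rule U.free_pair_by_ping_pong[where T = act and ?v0.0 = "vec 1 1" and D = D])
    show "B \<in> carrier (units_of R)" "u0 \<in> carrier (units_of R)"
      using B_unit u0_unit by (simp_all add: units_of_carrier)
    show "act (a \<otimes>\<^bsub>units_of R\<^esub> b) v = act a (act b v)"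
      if "a \<in> carrier (units_of R)" "b \<in> carrier (units_of R)" for a b v
      using that by (simp add: units_of_carrier units_of_mult act_mult R.Units_closed)
    show "act \<one>\<^bsub>units_of R\<^esub> (vec 1 1) = vec 1 1" by (simp add: units_of_one act_one)
    have D_I: "case_prod vec pq \<in> D l" if "case_prod (region l) pq" for l pq
      using that by (auto simp: D_def)
    show "act (letter_value (units_of R) B u0 l) v \<in> D l"
      if not_cancelling: "\<not> cancelling l l'" and v: "v \<in> D l'" for l l' v
    proof -
      obtain p q where pq: "v = vec p q" "region l' p q" using v by (auto simp: D_def)
      show ?thesis unfolding pq(1) letter by (rule D_I[OF region_step[OF not_cancelling pq(2)]])
    qed
    show "act (letter_value (units_of R) B u0 l) (vec 1 1) \<in> D l" for l
      unfolding letter by (rule D_I[OF region_base(1)])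
    show "vec 1 1 \<notin> D l" for l using region_base(2) by (auto simp: D_def vec_eq_iff)
    show "D l \<inter> D l' = {}" if "l \<noteq> l'" for l l'
      using that region_disjoint[of l _ _ l'] by (auto simp: D_def vec_eq_iff)
  qed
  then show ?thesis by (simp only: B_def)
qed

end

section \<open>Symmetric and alternating groups\<close>

lemma finite_sym_group: "finite (carrier (sym_group n))"
  using finite_permutations[of "{1..n}"] by (simp add: sym_group_def)

lemma permutation_group_sym: "permutation_group (sym_group n)"
proof (intro_locales)
  show "Group.monoid (sym_group n)" using sym_group_is_group by (rule group.is_monoid)
  show "group_axioms (sym_group n)" using sym_group_is_group by (simp add: group_def)
  show "finite_group_axioms (sym_group n)"
    by (simp add: finite_group_axioms_def finite_sym_group)
  show "permutation_group_axioms (sym_group n)"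
    by (auto simp: permutation_group_axioms_def sym_group_mult sym_group_one sym_group_carrier
        permutes_bij)
qed

lemma permutation_group_alt: "permutation_group (alt_group n)"
proof (intro_locales)
  show "Group.monoid (alt_group n)" using alt_group_is_group by (rule group.is_monoid)
  show "group_axioms (alt_group n)" using alt_group_is_group[of n] by (simp add: group_def)
  have "carrier (alt_group n) \<subseteq> carrier (sym_group n)"
    by (auto simp: alt_group_carrier sym_group_carrier)
  then show "finite_group_axioms (alt_group n)"
    using finite_sym_group finite_subset by (auto simp: finite_group_axioms_def)
  show "permutation_group_axioms (alt_group n)"
    by (auto simp: permutation_group_axioms_def alt_group_mult alt_group_one alt_group_carrier
        permutes_bij)
qed

text \<open>
  A permutation of four letters is a four-cycle, has order at most two, or is a three-cycle.
\<close>

lemma small_permutation_power: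
  assumes "p permutes {1, 2, 3, 4 :: nat}"
  shows "p ^^ 4 = id \<or> p ^^ 3 = id"
proof -
  have "p i \<in> {1, 2, 3, 4}" if "i \<in> {1, 2, 3, 4}" for i
    using that by (simp only: permutes_in_image[OF assms])
  then have dom: "p 1 \<in> {1, 2, 3, 4}" "p 2 \<in> {1, 2, 3, 4}" "p 3 \<in> {1, 2, 3, 4}" "p 4 \<in> {1, 2, 3, 4}"
    by simp_all
  have inj: "p i = p j \<longleftrightarrow> i = j" for i j using permutes_inj[OF assms] by (simp add: inj_eq)
  have fixed: "(p ^^ k) i = i" if "i \<notin> {1, 2, 3, 4}" for i k
    using permutes_not_in[OF assms that] by (induction k) auto
  have ext: "p ^^ k = id" if "(p ^^ k) 1 = 1" "(p ^^ k) 2 = 2" "(p ^^ k) 3 = 3" "(p ^^ k) 4 = 4" for k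
  proof
    fix i
    show "(p ^^ k) i = id i" using that fixed[of i k] by (cases "i \<in> {1, 2, 3, 4}") auto
  qed
  have distinct: "p 1 \<noteq> p 2" "p 1 \<noteq> p 3" "p 1 \<noteq> p 4" "p 2 \<noteq> p 3" "p 2 \<noteq> p 4" "p 3 \<noteq> p 4"
    by (simp_all add: inj)
  have pow: "(p ^^ 4) i = p (p (p (p i)))" "(p ^^ 3) i = p (p (p i))" for i
    by (simp_all add: eval_nat_numeral)
  have "(p ^^ 4) 1 = 1 \<and> (p ^^ 4) 2 = 2 \<and> (p ^^ 4) 3 = 3 \<and> (p ^^ 4) 4 = 4 \<or>
      (p ^^ 3) 1 = 1 \<and> (p ^^ 3) 2 = 2 \<and> (p ^^ 3) 3 = 3 \<and> (p ^^ 3) 4 = 4"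
    unfolding pow using dom distinct
  proof (elim insertE emptyE)
  qed simp_all
  then show ?thesis using ext by blast
qed

lemma (in permutation_group) ord_small:
  assumes "p \<in> carrier G" "p permutes {1..n}" "n \<le> 4"
  shows "ord p \<in> {1, 2, 3, 4, 6}"
proof -
  have "{1..n} \<subseteq> {1, 2, 3, 4}" using assms(3) by auto
  then have "p permutes {1, 2, 3, 4}" using assms(2) by (rule permutes_subset[rotated])
  then have *: "p ^^ 4 = id \<or> p ^^ 3 = id" by (rule small_permutation_power)
  have "p [^] k = p ^^ k" for k :: nat
    by (induction k) (simp_all add: mult_comp one_id funpow_Suc_right del: funpow.simps(2))
  then have "ord p dvd 4 \<or> ord p dvd 3"
    using * pow_eq_id[OF assms(1), of 4] pow_eq_id[OF assms(1), of 3] by (simp add: one_id)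
  then have "ord p \<le> 4" using dvd_imp_le[of "ord p" 4] dvd_imp_le[of "ord p" 3] by linarith
  then have "ord p = 1 \<or> ord p = 2 \<or> ord p = 3 \<or> ord p = 4"
    using ord_pos[OF assms(1)] by linarith
  then show ?thesis by blast
qed

lemma witnesses_even: 
  assumes "5 \<le> n"
  shows "h0 \<in> carrier (alt_group n)" "x0 \<in> carrier (alt_group n)" "y0 \<in> carrier (alt_group n)"
proof -
  have even: "transpose a b \<circ> transpose c d \<in> carrier (alt_group n)"
    if "a \<in> {1..n}" "b \<in> {1..n}" "c \<in> {1..n}" "d \<in> {1..n}" "a \<noteq> b" "c \<noteq> d" for a b c d
    using that unfolding alt_group_carrier
    by (simp add: permutes_compose permutes_swap_id evenperm_comp evenperm_swap permutation_swap_id)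
  interpret permutation_group "alt_group n" by (rule permutation_group_alt)
  have h0: "h0 = transpose 1 2 \<circ> transpose 4 5"
    by (auto simp: h0_def fun_eq_iff transpose_def)
  show "h0 \<in> carrier (alt_group n)" unfolding h0 by (rule even) (use assms in auto)
  have x0: "x0 = transpose 1 3 \<circ> transpose 2 3"
    by (auto simp: x0_def fun_eq_iff transpose_def)
  show "x0 \<in> carrier (alt_group n)" unfolding x0 by (rule even) (use assms in auto)
  have "y0 = (transpose 1 2 \<circ> transpose 2 3) \<circ> (transpose 3 4 \<circ> transpose 4 5)"
    by (auto simp: y0_def fun_eq_iff transpose_def)
  moreover have "transpose 1 2 \<circ> transpose 2 3 \<in> carrier (alt_group n)"
      "transpose 3 4 \<circ> transpose 4 5 \<in> carrier (alt_group n)"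
    by (rule even; use assms in auto)+
  ultimately show "y0 \<in> carrier (alt_group n)" using m_closed by (metis mult_comp)
qed

text \<open>
  The witnesses are even, so they belong to every such group between \<open>A\<^sub>n\<close> and \<open>S\<^sub>n\<close>.
\<close>

lemma (in permutation_group) free_pair_iff:
  assumes perm: "\<And>p. p \<in> carrier G \<Longrightarrow> p permutes {1..n}"
    and alt: "carrier (alt_group n) \<subseteq> carrier G"
  shows "(\<exists>b \<in> bicyclic_units G. \<exists>u \<in> bass_cyclic_units G. \<exists>k :: int.
    free_pair (units_of R) (b [^]\<^bsub>units_of R\<^esub> k) u) \<longleftrightarrow> n \<ge> 5"
proof
  assume "\<exists>b \<in> bicyclic_units G. \<exists>u \<in> bass_cyclic_units G. \<exists>k :: int.
    free_pair (units_of R) (b [^]\<^bsub>units_of R\<^esub> k) u"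
  then obtain b u and k :: int where u: "u \<in> bass_cyclic_units G"
    and free: "free_pair (units_of R) (b [^]\<^bsub>units_of R\<^esub> k) u" by blast
  show "n \<ge> 5"
  proof (rule ccontr)
    assume "\<not> n \<ge> 5"
    then have "ord p \<in> {1, 2, 3, 4, 6}" if "p \<in> carrier G" for p
      using ord_small[OF that perm[OF that]] by simp
    then show False using no_free_pair_with_bass_unit[OF _ u] free by blast
  qed
next
  assume "n \<ge> 5"
  then interpret five_letters G
    using witnesses_even[of n] alt by unfold_locales blast+
  show "\<exists>b \<in> bicyclic_units G. \<exists>u \<in> bass_cyclic_units G. \<exists>k :: int.
      free_pair (units_of R) (b [^]\<^bsub>units_of R\<^esub> k) u"
    using b0_bicyclic u0_bass free_pair_b0_u0 by blast
qed

theorem theorem7p3: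
  fixes n :: nat
  assumes "n > 0"
  shows "((\<exists>b \<in> bicyclic_units (alt_group n). \<exists>u \<in> bass_cyclic_units (alt_group n). \<exists>k :: int.
            free_pair (units_of (group_ring (alt_group n)))
              (b [^]\<^bsub>units_of (group_ring (alt_group n))\<^esub> k) u) \<longleftrightarrow> n \<ge> 5) \<and>
         ((\<exists>b \<in> bicyclic_units (sym_group n). \<exists>u \<in> bass_cyclic_units (sym_group n). \<exists>k :: int.
            free_pair (units_of (group_ring (sym_group n)))
              (b [^]\<^bsub>units_of (group_ring (sym_group n))\<^esub> k) u) \<longleftrightarrow> n \<ge> 5)"
  using permutation_group.free_pair_iff[OF permutation_group_alt[of n], of n]
    permutation_group.free_pair_iff[OF permutation_group_sym[of n], of n]
  by (simp add: alt_group_carrier sym_group_carrier subset_iff)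

end
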